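(* Let $n$ be a natural number, let $R$ be an integral domain, let $c_{i,j}\in R$ ($i,j\in\{1,\dots,n\}$) and $\alpha_i\in R$ ($i\in\{1,\dots,n\}$) be invertible, and let $\beta_i\in R$ ($i\in\{1,\dots,n\}$). Let $T_n$ be the associated $R$-algebra with generators $f_{i,j}$, let $Y_i=\alpha_i f_{i,i}+\beta_i\in T_n$ (invertibility of $\alpha_i$ makes $Y_i$ invertible), and for $i\in\{1,\dots,n-1\}$ let $\phi(X_i):T_n\to T_n$ be the $R$-linear operator defined in the context. Suppose that there are $\beta,c\in R$ such that (1) $\beta_i=\beta$ for all $i\in\{1,\dots,n\}$; (2) $\alpha_i=c_{i-1,i-1}\,\alpha_{i-1}/c_{i,i}$ for all $i\in\{2,\dots,n\}$; (3) $c_{i,j}=c$ for all $i,j\in\{1,\dots,n\}$. Then the map $\phi$ is a representation of the $n$-string braid group $B_n$ on $T_n$; that is, $X_i\mapsto\phi(X_i)$ extends to a group homomorphism from $B_n$ to the group of invertible $R$-linear operators on $T_n$.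
   Context: The $n$-string braid group $B_n$ is the group with generators $X_1,\dots,X_{n-1}$ and relations $X_iX_jX_i=X_jX_iX_j$ for $|i-j|=1$ and $X_iX_j=X_jX_i$ for $|i-j|>1$. For parameters $c_{i,j}\in R$, $T_n$ is the unital $R$-algebra generated by elements $f_{i,j}$, $i,j\in\{1,\dots,n\}$, with relations $f_{i,j}f_{k,l}=c_{j,k}f_{i,l}$ for all $i,j,k,l$. It is a free $R$-module of rank $n^2+1$ with basis $1$ and all $f_{i,j}$. Scalars are identified with multiples of $1$, so $Y_i=\alpha_i f_{i,i}+\beta_i$ means $\alpha_i f_{i,i}+\beta_i\cdot 1$, and $Y_i^{-1}$ denotes the inverse of $Y_i$ in $T_n$. For $i\in\{1,\dots,n-1\}$ the operator $\phi(X_i)$ is the $R$-linear map $T_n\to T_n$ defined on this basis by: - $\phi(X_i)(1)=1$; - $\phi(X_i)(f_{j,j})=f_{j,j}$ for $j\ne i,i+1$; - $\phi(X_i)(f_{i+1,i+1})=f_{i,i}$; - $\phi(X_i)(f_{i,i})=\alpha_i^{-1}\left(Y_iY_{i+1}Y_i^{-1}-\beta_i\right)$; - $\phi(X_i)(f_{k,l})=\phi(X_i)(f_{k,k})\,\phi(X_i)(f_{l,l})\,c_{k,l}^{-1}$ for all $k\neq l$ in $\{1,\dots,n\}$.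
   Formalization: The formal statement also assumes that Y_i is invertible in T_n for i in {1,…,n-1}; invertibility of α_i does not imply this (for β=0, Y_i=α_i f_{i,i} is not invertible), and without it φ(X_i) is undefined. *)

theory Defs
  imports "HOL-Algebra.Bij" "HOL-Algebra.Module"
begin

section \<open>Groups given by generators and relations\<close>

text \<open>
  Words are lists of letters \<open>(x, e)\<close>, where \<open>(x, True)\<close> stands for the generator \<open>x\<close> and
  \<open>(x, False)\<close> for its formal inverse.
\<close>

definition group_words :: "'x set \<Rightarrow> ('x \<times> bool) list set"
  where "group_words S = lists (S \<times> UNIV)"

inductive_set group_cong ::
  "'x set \<Rightarrow> (('x \<times> bool) list \<times> ('x \<times> bool) list) set
    \<Rightarrow> (('x \<times> bool) list \<times> ('x \<times> bool) list) set"
  for S Rel where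
  refl: "u \<in> group_words S \<Longrightarrow> (u, u) \<in> group_cong S Rel"
| sym: "(u, v) \<in> group_cong S Rel \<Longrightarrow> (v, u) \<in> group_cong S Rel"
| trans: "(u, v) \<in> group_cong S Rel \<Longrightarrow> (v, w) \<in> group_cong S Rel \<Longrightarrow> (u, w) \<in> group_cong S Rel"
| append: "(u, u') \<in> group_cong S Rel \<Longrightarrow> (v, v') \<in> group_cong S Rel
    \<Longrightarrow> (u @ v, u' @ v') \<in> group_cong S Rel"
| cancel: "x \<in> S \<Longrightarrow> ([(x, e), (x, \<not> e)], []) \<in> group_cong S Rel"
| rel: "(u, v) \<in> Rel \<Longrightarrow> u \<in> group_words S \<Longrightarrow> v \<in> group_words S \<Longrightarrow> (u, v) \<in> group_cong S Rel"

definition presented_group ::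
  "'x set \<Rightarrow> (('x \<times> bool) list \<times> ('x \<times> bool) list) set \<Rightarrow> ('x \<times> bool) list set monoid"
  where "presented_group S Rel =
    \<lparr>carrier = group_words S // group_cong S Rel,
     mult = (\<lambda>U V. \<Union>u\<in>U. \<Union>v\<in>V. group_cong S Rel `` {u @ v}),
     one = group_cong S Rel `` {[]}\<rparr>"

lemma group_words_simps [simp]:
  "[] \<in> group_words S" "u @ v \<in> group_words S \<longleftrightarrow> u \<in> group_words S \<and> v \<in> group_words S"
  "(x, e) # u \<in> group_words S \<longleftrightarrow> x \<in> S \<and> u \<in> group_words S"
  by (auto simp: group_words_def)

lemma group_cong_words:
  "(u, v) \<in> group_cong S Rel \<Longrightarrow> u \<in> group_words S \<and> v \<in> group_words S"
  by (induction rule: group_cong.induct) auto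

lemma equiv_group_cong: "equiv (group_words S) (group_cong S Rel)"
  by (rule equivI)
    (auto simp: refl_on_def sym_def trans_def
      intro: group_cong.refl group_cong.sym group_cong.trans dest: group_cong_words)

lemma presented_group_mult:
  assumes "u \<in> group_words S" "v \<in> group_words S"
  shows "group_cong S Rel `` {u} \<otimes>\<^bsub>presented_group S Rel\<^esub> group_cong S Rel `` {v}
    = group_cong S Rel `` {u @ v}"
proof -
  have "(\<Union>x\<in>group_cong S Rel `` {u}. \<Union>y\<in>group_cong S Rel `` {v}. group_cong S Rel `` {x @ y})
    = group_cong S Rel `` {u @ v}"
    by (rule UN_equiv_class2[OF equiv_group_cong equiv_group_cong _ assms])
      (auto intro!: congruent2I' equiv_class_eq[OF equiv_group_cong] group_cong.append)
  then show ?thesis by (simp add: presented_group_def)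
qed

lemma group_word_inverse:
  "u \<in> group_words S \<Longrightarrow> \<exists>v\<in>group_words S. (v @ u, []) \<in> group_cong S Rel"
proof (induction u)
  case Nil
  show ?case by (rule bexI[of _ "[]"]) (simp_all add: group_cong.refl)
next
  case (Cons a u)
  obtain x e where a: "a = (x, e)" by force
  with Cons obtain v where x: "x \<in> S" and u: "u \<in> group_words S"
    and v: "v \<in> group_words S" "(v @ u, []) \<in> group_cong S Rel"
    by auto
  have "([(x, \<not> e), (x, e)] @ u, [] @ u) \<in> group_cong S Rel"
    using group_cong.cancel[OF x, of "\<not> e"] u by (intro group_cong.append group_cong.refl) simp_all
  then have "(v @ [(x, \<not> e), (x, e)] @ u, v @ [] @ u) \<in> group_cong S Rel"
    by (rule group_cong.append[OF group_cong.refl[OF v(1)]])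
  then have "((v @ [(x, \<not> e)]) @ a # u, []) \<in> group_cong S Rel"
    using v(2) a by (auto intro: group_cong.trans)
  moreover have "v @ [(x, \<not> e)] \<in> group_words S" using x v by simp
  ultimately show ?case by (rule bexI)
qed

lemma group_presented_group: "group (presented_group S Rel)"
proof (rule groupI)
  let ?G = "presented_group S Rel" and ?cl = "\<lambda>u. group_cong S Rel `` {u}"
  have cl: "u \<in> group_words S \<Longrightarrow> ?cl u \<in> carrier ?G" for u
    by (simp add: presented_group_def quotientI)
  have ex: "\<exists>u\<in>group_words S. U = ?cl u" if "U \<in> carrier ?G" for U
    using that by (auto simp: presented_group_def elim!: quotientE)
  have one: "\<one>\<^bsub>?G\<^esub> = ?cl []" by (simp add: presented_group_def)
  show "\<one>\<^bsub>?G\<^esub> \<in> carrier ?G" by (simp add: one cl)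
  fix U assume "U \<in> carrier ?G"
  then obtain u where u: "u \<in> group_words S" "U = ?cl u" using ex by blast
  show "\<one>\<^bsub>?G\<^esub> \<otimes>\<^bsub>?G\<^esub> U = U"
    unfolding one u(2) by (subst presented_group_mult) (simp_all add: u(1))
  obtain v where v: "v \<in> group_words S" "(v @ u, []) \<in> group_cong S Rel"
    using group_word_inverse[OF u(1)] by blast
  have "?cl v \<otimes>\<^bsub>?G\<^esub> U = \<one>\<^bsub>?G\<^esub>"
    unfolding one u(2) presented_group_mult[OF v(1) u(1)]
    by (rule equiv_class_eq[OF equiv_group_cong v(2)])
  then show "\<exists>V\<in>carrier ?G. V \<otimes>\<^bsub>?G\<^esub> U = \<one>\<^bsub>?G\<^esub>" using cl[OF v(1)] by blast
  fix V assume "V \<in> carrier ?G"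
  then obtain v where v: "v \<in> group_words S" "V = ?cl v" using ex by blast
  show "U \<otimes>\<^bsub>?G\<^esub> V \<in> carrier ?G"
    by (simp add: u v presented_group_mult cl)
  fix W assume "W \<in> carrier ?G"
  then obtain w where w: "w \<in> group_words S" "W = ?cl w" using ex by blast
  show "U \<otimes>\<^bsub>?G\<^esub> V \<otimes>\<^bsub>?G\<^esub> W = U \<otimes>\<^bsub>?G\<^esub> (V \<otimes>\<^bsub>?G\<^esub> W)"
    by (simp add: u v w presented_group_mult)
qed

definition braid_relations :: "nat \<Rightarrow> ((nat \<times> bool) list \<times> (nat \<times> bool) list) set"
  where "braid_relations n =
    {([(i, True), (j, True), (i, True)], [(j, True), (i, True), (j, True)]) | i j.
       i \<in> {1..<n} \<and> j \<in> {1..<n} \<and> \<bar>int i - int j\<bar> = 1} \<union>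
    {([(i, True), (j, True)], [(j, True), (i, True)]) | i j.
       i \<in> {1..<n} \<and> j \<in> {1..<n} \<and> \<bar>int i - int j\<bar> > 1}"

definition braid_group :: "nat \<Rightarrow> (nat \<times> bool) list set monoid"
  where "braid_group n = presented_group {1..<n} (braid_relations n)"

definition braid_gen :: "nat \<Rightarrow> nat \<Rightarrow> (nat \<times> bool) list set"
  where "braid_gen n i = group_cong {1..<n} (braid_relations n) `` {[(i, True)]}"


section \<open>Unital associative algebras given by generators and relations\<close>

text \<open>
  The algebra is the set of terms over scalars and generators, modulo the least congruence
  that contains the given relations and the axioms of a unital associative (not necessarily
  commutative) \<open>R\<close>-algebra, i.e. of a ring together with a ring homomorphism \<open>Scal\<close>
  from \<open>R\<close> to its centre.
\<close>

datatype (alg_scalars: 'a, alg_gens: 'x) alg_term =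
    Scal 'a
  | Gen 'x
  | Neg "('a, 'x) alg_term"
  | Add "('a, 'x) alg_term" "('a, 'x) alg_term"
  | Mul "('a, 'x) alg_term" "('a, 'x) alg_term"

definition alg_terms :: "('a, 'm) ring_scheme \<Rightarrow> 'x set \<Rightarrow> ('a, 'x) alg_term set"
  where "alg_terms R X = {t. alg_scalars t \<subseteq> carrier R \<and> alg_gens t \<subseteq> X}"

inductive_set alg_cong ::
  "('a, 'm) ring_scheme \<Rightarrow> 'x set \<Rightarrow> (('a, 'x) alg_term \<times> ('a, 'x) alg_term) set
    \<Rightarrow> (('a, 'x) alg_term \<times> ('a, 'x) alg_term) set"
  for R (structure) and X Rel where
  refl: "t \<in> alg_terms R X \<Longrightarrow> (t, t) \<in> alg_cong R X Rel"
| sym: "(s, t) \<in> alg_cong R X Rel \<Longrightarrow> (t, s) \<in> alg_cong R X Rel"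
| trans: "(s, t) \<in> alg_cong R X Rel \<Longrightarrow> (t, u) \<in> alg_cong R X Rel \<Longrightarrow> (s, u) \<in> alg_cong R X Rel"
| neg: "(s, s') \<in> alg_cong R X Rel \<Longrightarrow> (Neg s, Neg s') \<in> alg_cong R X Rel"
| add: "(s, s') \<in> alg_cong R X Rel \<Longrightarrow> (t, t') \<in> alg_cong R X Rel
    \<Longrightarrow> (Add s t, Add s' t') \<in> alg_cong R X Rel"
| mul: "(s, s') \<in> alg_cong R X Rel \<Longrightarrow> (t, t') \<in> alg_cong R X Rel
    \<Longrightarrow> (Mul s t, Mul s' t') \<in> alg_cong R X Rel"
| add_assoc: "{s, t, u} \<subseteq> alg_terms R X
    \<Longrightarrow> (Add (Add s t) u, Add s (Add t u)) \<in> alg_cong R X Rel"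
| add_comm: "{s, t} \<subseteq> alg_terms R X \<Longrightarrow> (Add s t, Add t s) \<in> alg_cong R X Rel"
| add_zero: "t \<in> alg_terms R X \<Longrightarrow> (Add (Scal \<zero>) t, t) \<in> alg_cong R X Rel"
| add_neg: "t \<in> alg_terms R X \<Longrightarrow> (Add (Neg t) t, Scal \<zero>) \<in> alg_cong R X Rel"
| mul_assoc: "{s, t, u} \<subseteq> alg_terms R X
    \<Longrightarrow> (Mul (Mul s t) u, Mul s (Mul t u)) \<in> alg_cong R X Rel"
| mul_one: "t \<in> alg_terms R X \<Longrightarrow> (Mul (Scal \<one>) t, t) \<in> alg_cong R X Rel"
| distrib_right: "{s, t, u} \<subseteq> alg_terms R X
    \<Longrightarrow> (Mul (Add s t) u, Add (Mul s u) (Mul t u)) \<in> alg_cong R X Rel"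
| distrib_left: "{s, t, u} \<subseteq> alg_terms R X
    \<Longrightarrow> (Mul u (Add s t), Add (Mul u s) (Mul u t)) \<in> alg_cong R X Rel"
| scal_add: "{a, b} \<subseteq> carrier R \<Longrightarrow> (Scal (a \<oplus> b), Add (Scal a) (Scal b)) \<in> alg_cong R X Rel"
| scal_mul: "{a, b} \<subseteq> carrier R \<Longrightarrow> (Scal (a \<otimes> b), Mul (Scal a) (Scal b)) \<in> alg_cong R X Rel"
| scal_central: "a \<in> carrier R \<Longrightarrow> t \<in> alg_terms R X
    \<Longrightarrow> (Mul (Scal a) t, Mul t (Scal a)) \<in> alg_cong R X Rel"
| rel: "(s, t) \<in> Rel \<Longrightarrow> s \<in> alg_terms R X \<Longrightarrow> t \<in> alg_terms R X \<Longrightarrow> (s, t) \<in> alg_cong R X Rel"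

definition presented_algebra ::
  "('a, 'm) ring_scheme \<Rightarrow> 'x set \<Rightarrow> (('a, 'x) alg_term \<times> ('a, 'x) alg_term) set
    \<Rightarrow> ('a, ('a, 'x) alg_term set) module"
  where "presented_algebra R X Rel =
    \<lparr>carrier = alg_terms R X // alg_cong R X Rel,
     mult = (\<lambda>S T. \<Union>s\<in>S. \<Union>t\<in>T. alg_cong R X Rel `` {Mul s t}),
     one = alg_cong R X Rel `` {Scal \<one>\<^bsub>R\<^esub>},
     zero = alg_cong R X Rel `` {Scal \<zero>\<^bsub>R\<^esub>},
     add = (\<lambda>S T. \<Union>s\<in>S. \<Union>t\<in>T. alg_cong R X Rel `` {Add s t}),
     smult = (\<lambda>a T. \<Union>t\<in>T. alg_cong R X Rel `` {Mul (Scal a) t})\<rparr>"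

lemma alg_terms_simps [simp]:
  "Scal a \<in> alg_terms R X \<longleftrightarrow> a \<in> carrier R"
  "Gen x \<in> alg_terms R X \<longleftrightarrow> x \<in> X"
  "Neg s \<in> alg_terms R X \<longleftrightarrow> s \<in> alg_terms R X"
  "Add s t \<in> alg_terms R X \<longleftrightarrow> s \<in> alg_terms R X \<and> t \<in> alg_terms R X"
  "Mul s t \<in> alg_terms R X \<longleftrightarrow> s \<in> alg_terms R X \<and> t \<in> alg_terms R X"
  by (auto simp: alg_terms_def)

lemma alg_cong_terms:
  assumes "ring R" "(s, t) \<in> alg_cong R X Rel"
  shows "s \<in> alg_terms R X \<and> t \<in> alg_terms R X"
proof -
  interpret ring R by fact
  show ?thesis using assms(2) by (induction rule: alg_cong.induct) auto
qed

lemma equiv_alg_cong: "ring R \<Longrightarrow> equiv (alg_terms R X) (alg_cong R X Rel)"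
  by (rule equivI)
    (auto simp: refl_on_def sym_def trans_def
      intro: alg_cong.refl alg_cong.sym alg_cong.trans dest: alg_cong_terms)

lemma presented_algebra_simps:
  assumes "ring R" and st: "s \<in> alg_terms R X" "t \<in> alg_terms R X" and "a \<in> carrier R"
  shows "alg_cong R X Rel `` {s} \<otimes>\<^bsub>presented_algebra R X Rel\<^esub> alg_cong R X Rel `` {t}
      = alg_cong R X Rel `` {Mul s t}"
    and "alg_cong R X Rel `` {s} \<oplus>\<^bsub>presented_algebra R X Rel\<^esub> alg_cong R X Rel `` {t}
      = alg_cong R X Rel `` {Add s t}"
    and "a \<odot>\<^bsub>presented_algebra R X Rel\<^esub> alg_cong R X Rel `` {t}
      = alg_cong R X Rel `` {Mul (Scal a) t}"
proof -
  note eq = equiv_alg_cong[OF \<open>ring R\<close>, of X Rel]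
  let ?cl = "\<lambda>u. alg_cong R X Rel `` {u}"
  have "(\<Union>x\<in>?cl s. \<Union>y\<in>?cl t. ?cl (Mul x y)) = ?cl (Mul s t)"
    by (rule UN_equiv_class2[OF eq eq _ st])
      (auto intro!: congruent2I' equiv_class_eq[OF eq] alg_cong.mul)
  then show "?cl s \<otimes>\<^bsub>presented_algebra R X Rel\<^esub> ?cl t = ?cl (Mul s t)"
    by (simp add: presented_algebra_def)
  have "(\<Union>x\<in>?cl s. \<Union>y\<in>?cl t. ?cl (Add x y)) = ?cl (Add s t)"
    by (rule UN_equiv_class2[OF eq eq _ st])
      (auto intro!: congruent2I' equiv_class_eq[OF eq] alg_cong.add)
  then show "?cl s \<oplus>\<^bsub>presented_algebra R X Rel\<^esub> ?cl t = ?cl (Add s t)"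
    by (simp add: presented_algebra_def)
  have "(\<Union>y\<in>?cl t. ?cl (Mul (Scal a) y)) = ?cl (Mul (Scal a) t)"
    by (rule UN_equiv_class[OF eq _ st(2)])
      (auto intro!: congruentI equiv_class_eq[OF eq] alg_cong.mul alg_cong.refl simp: \<open>a \<in> carrier R\<close>)
  then show "a \<odot>\<^bsub>presented_algebra R X Rel\<^esub> ?cl t = ?cl (Mul (Scal a) t)"
    by (simp add: presented_algebra_def)
qed

lemma
  assumes "cring R"
  shows ring_presented_algebra: "ring (presented_algebra R X Rel)"
    and module_presented_algebra: "module R (presented_algebra R X Rel)"
    and presented_algebra_smult_assoc:
      "\<And>a x y. a \<in> carrier R \<Longrightarrow> x \<in> carrier (presented_algebra R X Rel)
        \<Longrightarrow> y \<in> carrier (presented_algebra R X Rel)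
        \<Longrightarrow> (a \<odot>\<^bsub>presented_algebra R X Rel\<^esub> x) \<otimes>\<^bsub>presented_algebra R X Rel\<^esub> y
          = a \<odot>\<^bsub>presented_algebra R X Rel\<^esub> (x \<otimes>\<^bsub>presented_algebra R X Rel\<^esub> y)
        \<and> x \<otimes>\<^bsub>presented_algebra R X Rel\<^esub> (a \<odot>\<^bsub>presented_algebra R X Rel\<^esub> y)
          = a \<odot>\<^bsub>presented_algebra R X Rel\<^esub> (x \<otimes>\<^bsub>presented_algebra R X Rel\<^esub> y)"
proof -
  interpret R: cring R by fact
  let ?A = "presented_algebra R X Rel" and ?cl = "\<lambda>t. alg_cong R X Rel `` {t}"
  let ?W = "alg_terms R X"
  note eqv = equiv_alg_cong[OF R.ring_axioms, of X Rel]
  have eq: "(s, t) \<in> alg_cong R X Rel \<Longrightarrow> ?cl s = ?cl t" for s t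
    by (rule equiv_class_eq[OF eqv])
  have cl [simp]: "t \<in> ?W \<Longrightarrow> ?cl t \<in> carrier ?A" for t
    by (simp add: presented_algebra_def quotientI)
  have ex: "\<exists>t\<in>?W. U = ?cl t" if "U \<in> carrier ?A" for U
    using that by (auto simp: presented_algebra_def elim!: quotientE)
  have one: "\<one>\<^bsub>?A\<^esub> = ?cl (Scal \<one>\<^bsub>R\<^esub>)" and zero: "\<zero>\<^bsub>?A\<^esub> = ?cl (Scal \<zero>\<^bsub>R\<^esub>)"
    by (simp_all add: presented_algebra_def)
  note ops = presented_algebra_simps[OF R.ring_axioms, of _ X _ _ Rel]
  have add [simp]: "?cl s \<oplus>\<^bsub>?A\<^esub> ?cl t = ?cl (Add s t)"
    and mul [simp]: "?cl s \<otimes>\<^bsub>?A\<^esub> ?cl t = ?cl (Mul s t)" if "s \<in> ?W" "t \<in> ?W" for s t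
    using that ops(1,2)[of s t "\<zero>\<^bsub>R\<^esub>"] by simp_all
  have smul [simp]: "a \<odot>\<^bsub>?A\<^esub> ?cl t = ?cl (Mul (Scal a) t)" if "a \<in> carrier R" "t \<in> ?W" for a t
    using that ops(3)[of t t a] by simp
  have ab: "abelian_group ?A"
  proof (rule abelian_groupI)
    fix U V W assume "U \<in> carrier ?A" "V \<in> carrier ?A" "W \<in> carrier ?A"
    then obtain u v w where [simp]: "u \<in> ?W" "v \<in> ?W" "w \<in> ?W"
      and [simp]: "U = ?cl u" "V = ?cl v" "W = ?cl w"
      using ex by meson
    show "U \<oplus>\<^bsub>?A\<^esub> V \<in> carrier ?A" by simp
    show "U \<oplus>\<^bsub>?A\<^esub> V \<oplus>\<^bsub>?A\<^esub> W = U \<oplus>\<^bsub>?A\<^esub> (V \<oplus>\<^bsub>?A\<^esub> W)"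
      by simp (rule eq, rule alg_cong.add_assoc, simp)
    show "U \<oplus>\<^bsub>?A\<^esub> V = V \<oplus>\<^bsub>?A\<^esub> U"
      by simp (rule eq, rule alg_cong.add_comm, simp)
    show "\<zero>\<^bsub>?A\<^esub> \<oplus>\<^bsub>?A\<^esub> U = U"
      by (simp add: zero) (rule eq, rule alg_cong.add_zero, simp)
    show "\<exists>Y\<in>carrier ?A. Y \<oplus>\<^bsub>?A\<^esub> U = \<zero>\<^bsub>?A\<^esub>"
      by (rule bexI[of _ "?cl (Neg u)"]) (simp_all add: zero eq alg_cong.add_neg)
  qed (simp add: zero)
  have mon: "monoid ?A"
  proof (rule monoidI)
    fix U V W assume "U \<in> carrier ?A" "V \<in> carrier ?A" "W \<in> carrier ?A"
    then obtain u v w where [simp]: "u \<in> ?W" "v \<in> ?W" "w \<in> ?W"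
      and [simp]: "U = ?cl u" "V = ?cl v" "W = ?cl w"
      using ex by meson
    show "U \<otimes>\<^bsub>?A\<^esub> V \<in> carrier ?A" by simp
    show "U \<otimes>\<^bsub>?A\<^esub> V \<otimes>\<^bsub>?A\<^esub> W = U \<otimes>\<^bsub>?A\<^esub> (V \<otimes>\<^bsub>?A\<^esub> W)"
      by simp (rule eq, rule alg_cong.mul_assoc, simp)
    show one_l: "\<one>\<^bsub>?A\<^esub> \<otimes>\<^bsub>?A\<^esub> U = U"
      by (simp add: one) (rule eq, rule alg_cong.mul_one, simp)
    have "\<one>\<^bsub>?A\<^esub> \<otimes>\<^bsub>?A\<^esub> U = U \<otimes>\<^bsub>?A\<^esub> \<one>\<^bsub>?A\<^esub>"
      by (simp add: one) (rule eq, rule alg_cong.scal_central, simp_all)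
    then show "U \<otimes>\<^bsub>?A\<^esub> \<one>\<^bsub>?A\<^esub> = U" using one_l by simp
  qed (simp add: one)
  show "ring ?A"
  proof (rule ringI[OF ab mon])
    fix U V W assume "U \<in> carrier ?A" "V \<in> carrier ?A" "W \<in> carrier ?A"
    then obtain u v w where [simp]: "u \<in> ?W" "v \<in> ?W" "w \<in> ?W"
      and [simp]: "U = ?cl u" "V = ?cl v" "W = ?cl w"
      using ex by meson
    show "(U \<oplus>\<^bsub>?A\<^esub> V) \<otimes>\<^bsub>?A\<^esub> W = U \<otimes>\<^bsub>?A\<^esub> W \<oplus>\<^bsub>?A\<^esub> V \<otimes>\<^bsub>?A\<^esub> W"
      by simp (rule eq, rule alg_cong.distrib_right, simp)
    show "W \<otimes>\<^bsub>?A\<^esub> (U \<oplus>\<^bsub>?A\<^esub> V) = W \<otimes>\<^bsub>?A\<^esub> U \<oplus>\<^bsub>?A\<^esub> W \<otimes>\<^bsub>?A\<^esub> V"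
      by simp (rule eq, rule alg_cong.distrib_left, simp)
  qed
  then interpret A: ring ?A .
  have scal: "a \<odot>\<^bsub>?A\<^esub> U = ?cl (Scal a) \<otimes>\<^bsub>?A\<^esub> U" if "a \<in> carrier R" "U \<in> carrier ?A" for a U
    using ex[OF that(2)] that(1) by auto
  have hom: "?cl (Scal (a \<oplus>\<^bsub>R\<^esub> b)) = ?cl (Scal a) \<oplus>\<^bsub>?A\<^esub> ?cl (Scal b)"
    "?cl (Scal (a \<otimes>\<^bsub>R\<^esub> b)) = ?cl (Scal a) \<otimes>\<^bsub>?A\<^esub> ?cl (Scal b)"
    if "a \<in> carrier R" "b \<in> carrier R" for a b
    using that by (simp_all add: eq alg_cong.scal_add alg_cong.scal_mul)
  have central: "?cl (Scal a) \<otimes>\<^bsub>?A\<^esub> U = U \<otimes>\<^bsub>?A\<^esub> ?cl (Scal a)"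
    if a: "a \<in> carrier R" and U: "U \<in> carrier ?A" for a U
  proof -
    obtain u where u: "u \<in> ?W" "U = ?cl u" using ex[OF U] by blast
    show ?thesis
      using a u(1) by (simp add: u(2)) (rule eq, rule alg_cong.scal_central)
  qed
  show "module R ?A"
    using \<open>cring R\<close> ab
    by (rule moduleI)
      (simp_all add: scal hom A.l_distr A.r_distr A.m_assoc one[symmetric] del: add mul)
  show "(a \<odot>\<^bsub>?A\<^esub> x) \<otimes>\<^bsub>?A\<^esub> y = a \<odot>\<^bsub>?A\<^esub> (x \<otimes>\<^bsub>?A\<^esub> y)
      \<and> x \<otimes>\<^bsub>?A\<^esub> (a \<odot>\<^bsub>?A\<^esub> y) = a \<odot>\<^bsub>?A\<^esub> (x \<otimes>\<^bsub>?A\<^esub> y)"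
    if "a \<in> carrier R" "x \<in> carrier ?A" "y \<in> carrier ?A" for a x y
    using that central[of a x]
    by (simp add: scal A.m_assoc) (metis A.m_assoc cl alg_terms_simps(1))
qed


section \<open>The algebra \<open>T\<^sub>n\<close>\<close>

definition T_relations ::
  "nat \<Rightarrow> (nat \<Rightarrow> nat \<Rightarrow> 'a)
    \<Rightarrow> (('a, nat \<times> nat) alg_term \<times> ('a, nat \<times> nat) alg_term) set"
  where "T_relations n c =
    {(Mul (Gen (i, j)) (Gen (k, l)), Mul (Scal (c j k)) (Gen (i, l))) | i j k l.
       {i, j, k, l} \<subseteq> {1..n}}"

definition T_alg ::
  "('a, 'm) ring_scheme \<Rightarrow> nat \<Rightarrow> (nat \<Rightarrow> nat \<Rightarrow> 'a)
    \<Rightarrow> ('a, ('a, nat \<times> nat) alg_term set) module"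
  where "T_alg R n c = presented_algebra R ({1..n} \<times> {1..n}) (T_relations n c)"

definition T_gen ::
  "('a, 'm) ring_scheme \<Rightarrow> nat \<Rightarrow> (nat \<Rightarrow> nat \<Rightarrow> 'a) \<Rightarrow> nat \<Rightarrow> nat
    \<Rightarrow> ('a, nat \<times> nat) alg_term set"
  where "T_gen R n c i j = alg_cong R ({1..n} \<times> {1..n}) (T_relations n c) `` {Gen (i, j)}"

lemma T_gen_mult:
  assumes "cring R" and c: "\<And>i j. i \<in> {1..n} \<Longrightarrow> j \<in> {1..n} \<Longrightarrow> c i j \<in> carrier R"
    and ijkl: "i \<in> {1..n}" "j \<in> {1..n}" "k \<in> {1..n}" "l \<in> {1..n}"
  shows "T_gen R n c i j \<in> carrier (T_alg R n c)"
    and "T_gen R n c i j \<otimes>\<^bsub>T_alg R n c\<^esub> T_gen R n c k l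
      = c j k \<odot>\<^bsub>T_alg R n c\<^esub> T_gen R n c i l"
proof -
  interpret R: cring R by fact
  let ?X = "{1..n} \<times> {1..n}"
  show "T_gen R n c i j \<in> carrier (T_alg R n c)"
    using ijkl by (simp add: T_gen_def T_alg_def presented_algebra_def quotientI)
  have "(Mul (Gen (i, j)) (Gen (k, l)), Mul (Scal (c j k)) (Gen (i, l)))
      \<in> alg_cong R ?X (T_relations n c)"
    using ijkl by (intro alg_cong.rel) (auto simp: T_relations_def c)
  from equiv_class_eq[OF equiv_alg_cong[OF R.ring_axioms] this]
  show "T_gen R n c i j \<otimes>\<^bsub>T_alg R n c\<^esub> T_gen R n c k l
      = c j k \<odot>\<^bsub>T_alg R n c\<^esub> T_gen R n c i l"
    using ijkl c[of j k] R.ring_axioms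
    by (simp add: T_gen_def T_alg_def
        presented_algebra_simps(1)[OF R.ring_axioms _ _ R.zero_closed]
        presented_algebra_simps(3)[where s = "Scal \<zero>\<^bsub>R\<^esub>"])
qed

definition Y_elem ::
  "('a, 'm) ring_scheme \<Rightarrow> nat \<Rightarrow> (nat \<Rightarrow> nat \<Rightarrow> 'a) \<Rightarrow> (nat \<Rightarrow> 'a) \<Rightarrow> (nat \<Rightarrow> 'a) \<Rightarrow> nat
    \<Rightarrow> ('a, nat \<times> nat) alg_term set"
  where "Y_elem R n c \<alpha> \<beta> i =
    (\<alpha> i \<odot>\<^bsub>T_alg R n c\<^esub> T_gen R n c i i) \<oplus>\<^bsub>T_alg R n c\<^esub>
    (\<beta> i \<odot>\<^bsub>T_alg R n c\<^esub> \<one>\<^bsub>T_alg R n c\<^esub>)"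


section \<open>Linear operators\<close>

definition linear_ops ::
  "('a, 'm) ring_scheme \<Rightarrow> ('a, 'b, 'k) module_scheme \<Rightarrow> ('b \<Rightarrow> 'b) set"
  where "linear_ops R M = {g \<in> carrier M \<rightarrow>\<^sub>E carrier M.
    (\<forall>x\<in>carrier M. \<forall>y\<in>carrier M. g (x \<oplus>\<^bsub>M\<^esub> y) = g x \<oplus>\<^bsub>M\<^esub> g y) \<and>
    (\<forall>a\<in>carrier R. \<forall>x\<in>carrier M. g (a \<odot>\<^bsub>M\<^esub> x) = a \<odot>\<^bsub>M\<^esub> g x)}"

text \<open>
  Operators are extensional functions, so that composition in \<open>BijGroup\<close> makes the invertible
  ones a group; the first factor of a product is applied last.
\<close>

definition linear_group ::
  "('a, 'm) ring_scheme \<Rightarrow> ('a, 'b, 'k) module_scheme \<Rightarrow> ('b \<Rightarrow> 'b) monoid"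
  where "linear_group R M = BijGroup (carrier M) \<lparr>carrier := Bij (carrier M) \<inter> linear_ops R M\<rparr>"

lemma group_linear_group:
  assumes "module R M"
  shows "group (linear_group R M)"
proof -
  interpret module R M by fact
  interpret B: group "BijGroup (carrier M)" by (rule group_BijGroup)
  have "subgroup (Bij (carrier M) \<inter> linear_ops R M) (BijGroup (carrier M))"
  proof (rule B.subgroupI)
    show "Bij (carrier M) \<inter> linear_ops R M \<subseteq> carrier (BijGroup (carrier M))"
      by (simp add: BijGroup_def)
    have "(\<lambda>x\<in>carrier M. x) \<in> Bij (carrier M) \<inter> linear_ops R M"
      by (simp add: id_Bij linear_ops_def)
    then show "Bij (carrier M) \<inter> linear_ops R M \<noteq> {}" by blast
  next
    fix g assume g: "g \<in> Bij (carrier M) \<inter> linear_ops R M"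
    then have bij: "bij_betw g (carrier M) (carrier M)" by (simp add: Bij_def)
    define h where "h = restrict (inv_into (carrier M) g) (carrier M)"
    have hg: "h x \<in> carrier M" "g (h x) = x" if "x \<in> carrier M" for x
      using that bij_betw_imp_surj_on[OF bij] inv_into_into[of x g "carrier M"]
        f_inv_into_f[of x g "carrier M"] by (simp_all add: h_def)
    have eqI: "x = y" if "x \<in> carrier M" "y \<in> carrier M" "g x = g y" for x y
      using that bij by (auto simp: bij_betw_def inj_on_def)
    have gadd: "g (x \<oplus>\<^bsub>M\<^esub> y) = g x \<oplus>\<^bsub>M\<^esub> g y" if "x \<in> carrier M" "y \<in> carrier M" for x y
      using g that by (simp add: linear_ops_def)
    have gsmult: "g (a \<odot>\<^bsub>M\<^esub> x) = a \<odot>\<^bsub>M\<^esub> g x" if "a \<in> carrier R" "x \<in> carrier M" for a x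
      using g that by (simp add: linear_ops_def)
    have "h \<in> linear_ops R M"
      unfolding linear_ops_def
    proof (intro CollectI conjI ballI)
      show "h \<in> carrier M \<rightarrow>\<^sub>E carrier M"
        using hg(1) by (simp add: PiE_iff) (simp add: h_def)
      show "h (x \<oplus>\<^bsub>M\<^esub> y) = h x \<oplus>\<^bsub>M\<^esub> h y" if "x \<in> carrier M" "y \<in> carrier M" for x y
        using that by - (rule eqI, simp_all add: gadd hg)
      show "h (a \<odot>\<^bsub>M\<^esub> x) = a \<odot>\<^bsub>M\<^esub> h x" if "a \<in> carrier R" "x \<in> carrier M" for a x
        using that by - (rule eqI, simp_all add: gsmult hg)
    qed
    then show "inv\<^bsub>BijGroup (carrier M)\<^esub> g \<in> Bij (carrier M) \<inter> linear_ops R M"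
      using g restrict_inv_into_Bij[of g "carrier M"] by (simp add: inv_BijGroup h_def)
  next
    fix g h assume gh: "g \<in> Bij (carrier M) \<inter> linear_ops R M" "h \<in> Bij (carrier M) \<inter> linear_ops R M"
    then have "h x \<in> carrier M" if "x \<in> carrier M" for x
      using that by (auto simp: linear_ops_def)
    moreover have "g x \<in> carrier M" if "x \<in> carrier M" for x
      using gh that by (auto simp: linear_ops_def)
    ultimately have "compose (carrier M) g h \<in> linear_ops R M"
      using gh unfolding linear_ops_def by (auto simp: compose_def PiE_iff)
    then show "g \<otimes>\<^bsub>BijGroup (carrier M)\<^esub> h \<in> Bij (carrier M) \<inter> linear_ops R M"
      using gh by (simp add: BijGroup_def compose_Bij)
  qed
  then show ?thesis
    unfolding linear_group_def by (rule subgroup.subgroup_is_group) (rule group_BijGroup)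
qed


section \<open>The operators \<open>\<phi>(X\<^sub>i)\<close>\<close>

text \<open>
  Since \<open>1\<close> and the \<open>f\<^sub>i\<^sub>j\<close> form an \<open>R\<close>-basis of \<open>T\<^sub>n\<close>, the values below determine exactly one
  linear operator.  They are meaningful only if \<open>Y\<^sub>i\<close> is a unit of \<open>T\<^sub>n\<close>, since \<open>inv\<close> is
  unspecified on other elements.
\<close>

definition is_phi ::
  "('a, 'm) ring_scheme \<Rightarrow> nat \<Rightarrow> (nat \<Rightarrow> nat \<Rightarrow> 'a) \<Rightarrow> (nat \<Rightarrow> 'a) \<Rightarrow> (nat \<Rightarrow> 'a) \<Rightarrow> nat
    \<Rightarrow> (('a, nat \<times> nat) alg_term set \<Rightarrow> ('a, nat \<times> nat) alg_term set) \<Rightarrow> bool"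
  where "is_phi R n c \<alpha> \<beta> i g \<longleftrightarrow>
    (let T = T_alg R n c; f = T_gen R n c; Y = Y_elem R n c \<alpha> \<beta> in
      g \<in> linear_ops R T \<and>
      g \<one>\<^bsub>T\<^esub> = \<one>\<^bsub>T\<^esub> \<and>
      (\<forall>j\<in>{1..n} - {i, i + 1}. g (f j j) = f j j) \<and>
      g (f (i + 1) (i + 1)) = f i i \<and>
      g (f i i) = inv\<^bsub>R\<^esub> (\<alpha> i) \<odot>\<^bsub>T\<^esub>
        ((Y i \<otimes>\<^bsub>T\<^esub> Y (i + 1) \<otimes>\<^bsub>T\<^esub> inv\<^bsub>T\<^esub> (Y i)) \<ominus>\<^bsub>T\<^esub> (\<beta> i \<odot>\<^bsub>T\<^esub> \<one>\<^bsub>T\<^esub>)) \<and>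
      (\<forall>k\<in>{1..n}. \<forall>l\<in>{1..n}. k \<noteq> l \<longrightarrow>
        g (f k l) = inv\<^bsub>R\<^esub> (c k l) \<odot>\<^bsub>T\<^esub> (g (f k k) \<otimes>\<^bsub>T\<^esub> g (f l l))))"

definition phi ::
  "('a, 'm) ring_scheme \<Rightarrow> nat \<Rightarrow> (nat \<Rightarrow> nat \<Rightarrow> 'a) \<Rightarrow> (nat \<Rightarrow> 'a) \<Rightarrow> (nat \<Rightarrow> 'a) \<Rightarrow> nat
    \<Rightarrow> ('a, nat \<times> nat) alg_term set \<Rightarrow> ('a, nat \<times> nat) alg_term set"
  where "phi R n c \<alpha> \<beta> i = (THE g. is_phi R n c \<alpha> \<beta> i g)"

end

theory Submission
  imports Defs
begin

text \<open>
  Since all \<open>c\<^sub>i\<^sub>j\<close> equal a unit \<open>c\<close>, there is an algebra homomorphism \<open>\<epsilon> : T\<^sub>n \<rightarrow> R\<close> sending every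
  \<open>f\<^sub>i\<^sub>j\<close> to \<open>c\<close>, and \<open>f\<^sub>k\<^sub>k x f\<^sub>l\<^sub>l = \<epsilon>(x) f\<^sub>k\<^sub>k f\<^sub>l\<^sub>l\<close> for all \<open>x\<close>.  It follows that for arbitrary units \<open>P\<^sub>k\<close>
  and any map \<open>\<pi>\<close> of the indices the elements \<open>F\<^sub>k = P\<^sub>k f\<^sub>\<pi>\<^sub>k\<^sub>,\<^sub>\<pi>\<^sub>k P\<^sub>k\<^sup>-\<^sup>1\<close> satisfy the relations of the
  \<open>f\<^sub>k\<^sub>k\<close>, so that \<open>f\<^sub>k\<^sub>k \<mapsto> F\<^sub>k\<close> extends to an algebra endomorphism; as \<open>\<alpha>\<close> and \<open>\<beta>\<close> are constant too,
  it maps \<open>Y\<^sub>k\<close> to \<open>P\<^sub>k Y\<^sub>\<pi>\<^sub>k P\<^sub>k\<^sup>-\<^sup>1\<close>.  In particular \<open>\<phi>(X\<^sub>i)\<close> is an algebra endomorphism that acts on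
  the units \<open>Y\<^sub>1, \<dots>, Y\<^sub>n\<close> by Artin's formulas for the action of \<open>B\<^sub>n\<close> on a free group.  Since the \<open>Y\<^sub>k\<close>
  generate \<open>T\<^sub>n\<close>, invertibility and the braid relations need only be verified on them.
\<close>

section \<open>Universal properties\<close>

definition word_eval :: "('g, 'k) monoid_scheme \<Rightarrow> ('x \<Rightarrow> 'g) \<Rightarrow> ('x \<times> bool) list \<Rightarrow> 'g"
  where "word_eval G F w =
    foldr (\<lambda>(x, e) a. (if e then F x else inv\<^bsub>G\<^esub> F x) \<otimes>\<^bsub>G\<^esub> a) w \<one>\<^bsub>G\<^esub>"

lemma word_eval_simps [simp]:
  "word_eval G F [] = \<one>\<^bsub>G\<^esub>"
  "word_eval G F ((x, e) # w) = (if e then F x else inv\<^bsub>G\<^esub> F x) \<otimes>\<^bsub>G\<^esub> word_eval G F w"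
  by (simp_all add: word_eval_def)

text \<open>Von Dyck's theorem. Evaluation of words respects every rule that generates the
  congruence, so the image of a class is a singleton, from which \<open>the_elem\<close> reads off
  the value of \<open>\<Phi>\<close>.\<close>

lemma presented_group_hom:
  assumes "group G" and F: "\<And>x. x \<in> S \<Longrightarrow> F x \<in> carrier G"
    and rel: "\<And>u v. (u, v) \<in> Rel \<Longrightarrow> u \<in> group_words S \<Longrightarrow> v \<in> group_words S
      \<Longrightarrow> word_eval G F u = word_eval G F v"
  obtains \<Phi> where "\<Phi> \<in> hom (presented_group S Rel) G"
    and "\<And>x. x \<in> S \<Longrightarrow> \<Phi> (group_cong S Rel `` {[(x, True)]}) = F x"
proof -
  interpret group G by fact
  let ?e = "word_eval G F" and ?cl = "\<lambda>u. group_cong S Rel `` {u}"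
  have closed [simp]: "u \<in> group_words S \<Longrightarrow> ?e u \<in> carrier G" for u
    by (induction u) (auto simp: F)
  have app: "?e (u @ v) = ?e u \<otimes>\<^bsub>G\<^esub> ?e v"
    if "u \<in> group_words S" "v \<in> group_words S" for u v
    using that by (induction u) (auto simp: F m_assoc)
  have cong: "?e u = ?e v" if "(u, v) \<in> group_cong S Rel" for u v
    using that
  proof (induction rule: group_cong.induct)
    case (append u u' v v')
    then show ?case by (auto simp: app dest!: group_cong_words)
  next
    case (cancel x e)
    then show ?case by (simp add: F)
  qed (auto intro: rel)
  define \<Phi> where "\<Phi> U = the_elem (?e ` U)" for U
  have \<Phi>: "\<Phi> (?cl u) = ?e u" if "u \<in> group_words S" for u
  proof -
    have "?e ` ?cl u = {?e u}"
      using that cong group_cong.refl[OF that] by auto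
    then show ?thesis by (simp add: \<Phi>_def)
  qed
  show ?thesis
  proof
    show "\<Phi> \<in> hom (presented_group S Rel) G"
    proof (rule homI)
      fix U assume "U \<in> carrier (presented_group S Rel)"
      then show "\<Phi> U \<in> carrier G"
        by (auto simp: presented_group_def \<Phi> elim!: quotientE)
    next
      fix U V
      assume "U \<in> carrier (presented_group S Rel)" "V \<in> carrier (presented_group S Rel)"
      then obtain u v where "u \<in> group_words S" "U = ?cl u" "v \<in> group_words S" "V = ?cl v"
        by (auto simp: presented_group_def elim!: quotientE)
      then show "\<Phi> (U \<otimes>\<^bsub>presented_group S Rel\<^esub> V) = \<Phi> U \<otimes>\<^bsub>G\<^esub> \<Phi> V"
        by (simp add: presented_group_mult \<Phi> app)
    qed
    show "\<Phi> (?cl [(x, True)]) = F x" if "x \<in> S" for x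
      using that by (simp add: \<Phi> F)
  qed
qed

primrec alg_eval ::
  "('b, 'k) ring_scheme \<Rightarrow> ('a \<Rightarrow> 'b) \<Rightarrow> ('x \<Rightarrow> 'b) \<Rightarrow> ('a, 'x) alg_term \<Rightarrow> 'b" where
  "alg_eval S \<iota> F (Scal a) = \<iota> a"
| "alg_eval S \<iota> F (Gen x) = F x"
| "alg_eval S \<iota> F (Neg t) = \<ominus>\<^bsub>S\<^esub> alg_eval S \<iota> F t"
| "alg_eval S \<iota> F (Add s t) = alg_eval S \<iota> F s \<oplus>\<^bsub>S\<^esub> alg_eval S \<iota> F t"
| "alg_eval S \<iota> F (Mul s t) = alg_eval S \<iota> F s \<otimes>\<^bsub>S\<^esub> alg_eval S \<iota> F t"

text \<open>The target is a ring with central scalars \<open>\<iota>\<close> rather than an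
  \<open>R\<close>-module, so that one statement serves both for maps to \<open>R\<close> itself
  (the augmentation) and for maps from \<open>T\<close> to \<open>T\<close>. As for groups,
  evaluation of terms is constant on congruence classes.\<close>

lemma presented_algebra_hom:
  assumes "cring R" and "ring S" and \<iota>: "\<iota> \<in> ring_hom R S"
    and central: "\<And>a x. a \<in> carrier R \<Longrightarrow> x \<in> carrier S \<Longrightarrow> \<iota> a \<otimes>\<^bsub>S\<^esub> x = x \<otimes>\<^bsub>S\<^esub> \<iota> a"
    and F: "\<And>x. x \<in> X \<Longrightarrow> F x \<in> carrier S"
    and rel: "\<And>s t. (s, t) \<in> Rel \<Longrightarrow> s \<in> alg_terms R X \<Longrightarrow> t \<in> alg_terms R X
      \<Longrightarrow> alg_eval S \<iota> F s = alg_eval S \<iota> F t"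
  obtains h where "h \<in> ring_hom (presented_algebra R X Rel) S"
    and "\<And>a x. a \<in> carrier R \<Longrightarrow> x \<in> carrier (presented_algebra R X Rel)
      \<Longrightarrow> h (a \<odot>\<^bsub>presented_algebra R X Rel\<^esub> x) = \<iota> a \<otimes>\<^bsub>S\<^esub> h x"
    and "\<And>x. x \<in> X \<Longrightarrow> h (alg_cong R X Rel `` {Gen x}) = F x"
proof -
  interpret R: cring R by fact
  interpret S: ring S by fact
  let ?A = "presented_algebra R X Rel"
  let ?e = "alg_eval S \<iota> F" and ?cl = "\<lambda>t. alg_cong R X Rel `` {t}"
  have \<iota>_simps [simp]: "\<iota> \<one>\<^bsub>R\<^esub> = \<one>\<^bsub>S\<^esub>" "\<iota> \<zero>\<^bsub>R\<^esub> = \<zero>\<^bsub>S\<^esub>"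
    "a \<in> carrier R \<Longrightarrow> \<iota> a \<in> carrier S"
    "a \<in> carrier R \<Longrightarrow> b \<in> carrier R \<Longrightarrow> \<iota> (a \<oplus>\<^bsub>R\<^esub> b) = \<iota> a \<oplus>\<^bsub>S\<^esub> \<iota> b"
    "a \<in> carrier R \<Longrightarrow> b \<in> carrier R \<Longrightarrow> \<iota> (a \<otimes>\<^bsub>R\<^esub> b) = \<iota> a \<otimes>\<^bsub>S\<^esub> \<iota> b" for a b
    using \<iota> ring_hom_zero[OF \<iota> R.ring_axioms S.ring_axioms]
    by (simp_all add: ring_hom_one ring_hom_closed ring_hom_add ring_hom_mult)
  have closed [simp]: "t \<in> alg_terms R X \<Longrightarrow> ?e t \<in> carrier S" for t
    by (induction t) (auto simp: F)
  have cong: "?e s = ?e t" if "(s, t) \<in> alg_cong R X Rel" for s t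
    using that
  proof (induction rule: alg_cong.induct)
    case (rel s t)
    then show ?case by (rule assms(6))
  next
    case (scal_central a t)
    then show ?case by (simp add: central)
  qed (simp_all add: S.add.m_ac S.m_assoc S.r_neg S.l_distr S.r_distr)
  define h where "h U = the_elem (?e ` U)" for U
  have h: "h (?cl t) = ?e t" if "t \<in> alg_terms R X" for t
  proof -
    have "?e ` ?cl t = {?e t}"
      using that cong alg_cong.refl[OF that] by auto
    then show ?thesis by (simp add: h_def)
  qed
  have ex: "\<exists>t\<in>alg_terms R X. U = ?cl t" if "U \<in> carrier ?A" for U
    using that by (auto simp: presented_algebra_def elim!: quotientE)
  note ops = presented_algebra_simps[OF R.ring_axioms]
  show ?thesis
  proof
    show "h \<in> ring_hom ?A S"
    proof (rule ring_hom_memI)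
      show "h U \<in> carrier S" if "U \<in> carrier ?A" for U
        using ex[OF that] by (auto simp: h)
      have "\<one>\<^bsub>?A\<^esub> = ?cl (Scal \<one>\<^bsub>R\<^esub>)" by (simp add: presented_algebra_def)
      then show "h \<one>\<^bsub>?A\<^esub> = \<one>\<^bsub>S\<^esub>" by (simp add: h)
      fix U V assume "U \<in> carrier ?A" "V \<in> carrier ?A"
      then obtain u v where [simp]: "u \<in> alg_terms R X" "v \<in> alg_terms R X"
        and [simp]: "U = ?cl u" "V = ?cl v"
        using ex by meson
      show "h (U \<otimes>\<^bsub>?A\<^esub> V) = h U \<otimes>\<^bsub>S\<^esub> h V"
        by (simp add: ops(1)[OF _ _ R.zero_closed] h)
      show "h (U \<oplus>\<^bsub>?A\<^esub> V) = h U \<oplus>\<^bsub>S\<^esub> h V"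
        by (simp add: ops(2)[OF _ _ R.zero_closed] h)
    qed
    show "h (a \<odot>\<^bsub>?A\<^esub> U) = \<iota> a \<otimes>\<^bsub>S\<^esub> h U" if a: "a \<in> carrier R" and U: "U \<in> carrier ?A" for a U
    proof -
      obtain u where "u \<in> alg_terms R X" "U = ?cl u" using ex[OF U] by blast
      with a show ?thesis by (simp add: ops(3)[where s = u] h)
    qed
    show "h (?cl (Gen x)) = F x" if "x \<in> X" for x
      using that by (simp add: h)
  qed
qed

lemma ring_hom_inv:
  assumes "monoid A" "monoid B" "h \<in> ring_hom A B" "x \<in> Units A"
  shows "h x \<in> Units B" "h (inv\<^bsub>A\<^esub> x) = inv\<^bsub>B\<^esub> h x"
proof -
  interpret A: monoid A by fact
  interpret B: monoid B by fact
  have eq: "h x \<otimes>\<^bsub>B\<^esub> h (inv\<^bsub>A\<^esub> x) = \<one>\<^bsub>B\<^esub>" "h (inv\<^bsub>A\<^esub> x) \<otimes>\<^bsub>B\<^esub> h x = \<one>\<^bsub>B\<^esub>"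
    using assms(4) ring_hom_mult[OF assms(3), of x "inv\<^bsub>A\<^esub> x", symmetric]
      ring_hom_mult[OF assms(3), of "inv\<^bsub>A\<^esub> x" x, symmetric] ring_hom_one[OF assms(3)]
    by (simp_all add: A.Units_closed)
  have cl: "h x \<in> carrier B" "h (inv\<^bsub>A\<^esub> x) \<in> carrier B"
    using assms(3,4) by (simp_all add: ring_hom_closed A.Units_closed)
  show "h x \<in> Units B" using eq cl by (auto simp: Units_def)
  show "h (inv\<^bsub>A\<^esub> x) = inv\<^bsub>B\<^esub> h x"
    using B.inv_char[OF cl eq] by simp
qed

section \<open>Algebra endomorphisms\<close>

text \<open>The members of \<open>linear_ops\<close> are extensional, so endomorphisms that agree on
  the carrier are equal as functions.\<close>

definition alg_endos :: "('a, 'm) ring_scheme \<Rightarrow> ('a, 'b, 'k) module_scheme \<Rightarrow> ('b \<Rightarrow> 'b) set"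
  where "alg_endos R M = linear_ops R M \<inter> ring_hom M M"

lemma alg_endos_simps:
  assumes "g \<in> alg_endos R M"
  shows "x \<in> carrier M \<Longrightarrow> g x \<in> carrier M"
    and "g \<one>\<^bsub>M\<^esub> = \<one>\<^bsub>M\<^esub>"
    and "x \<in> carrier M \<Longrightarrow> y \<in> carrier M \<Longrightarrow> g (x \<oplus>\<^bsub>M\<^esub> y) = g x \<oplus>\<^bsub>M\<^esub> g y"
    and "x \<in> carrier M \<Longrightarrow> y \<in> carrier M \<Longrightarrow> g (x \<otimes>\<^bsub>M\<^esub> y) = g x \<otimes>\<^bsub>M\<^esub> g y"
    and "a \<in> carrier R \<Longrightarrow> x \<in> carrier M \<Longrightarrow> g (a \<odot>\<^bsub>M\<^esub> x) = a \<odot>\<^bsub>M\<^esub> g x"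
  using assms
  by (auto simp: alg_endos_def linear_ops_def ring_hom_closed ring_hom_one ring_hom_mult)

lemma compose_alg_endos:
  assumes "g \<in> alg_endos R M" "h \<in> alg_endos R M" "module R M" "ring M"
  shows "compose (carrier M) g h \<in> alg_endos R M"
proof -
  interpret module R M by fact
  interpret ring M by fact
  note [simp] = alg_endos_simps[OF assms(1)] alg_endos_simps[OF assms(2)]
  show ?thesis
    unfolding alg_endos_def linear_ops_def
    by (auto simp: compose_def intro!: ring_hom_memI)
qed

lemma id_alg_endos:
  assumes "module R M" "ring M"
  shows "(\<lambda>x\<in>carrier M. x) \<in> alg_endos R M"
proof -
  interpret module R M by fact
  interpret ring M by fact
  show ?thesis
    unfolding alg_endos_def linear_ops_def by (auto intro!: ring_hom_memI)
qed

lemma Bij_alg_endos: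
  assumes g: "g \<in> alg_endos R M" and h: "h \<in> alg_endos R M"
    and "compose (carrier M) g h = (\<lambda>x\<in>carrier M. x)"
    and "compose (carrier M) h g = (\<lambda>x\<in>carrier M. x)"
  shows "g \<in> carrier (linear_group R M)"
proof -
  have "g (h x) = x" "h (g x) = x" if "x \<in> carrier M" for x
    using that fun_cong[OF assms(3), of x] fun_cong[OF assms(4), of x]
    by (simp_all add: compose_def)
  then have "bij_betw g (carrier M) (carrier M)"
    using alg_endos_simps(1)[OF g] alg_endos_simps(1)[OF h]
    by (intro bij_betwI[where g = h]) auto
  with g show ?thesis
    by (auto simp: linear_group_def Bij_def alg_endos_def linear_ops_def PiE_iff)
qed

section \<open>The algebra \<open>T\<^sub>n\<close> with constant structure parameter\<close>

text \<open>That \<open>c\<^sub>0\<close> is a unit is a separate assumption because for n = 0 there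
  is no c_{i,j} from which to infer it.\<close>

locale T_algebra = R: cring R for R (structure) +
  fixes n :: nat and c :: "nat \<Rightarrow> nat \<Rightarrow> 'a" and c\<^sub>0
  assumes c\<^sub>0_unit: "c\<^sub>0 \<in> Units R"
    and c_const: "\<And>i j. i \<in> {1..n} \<Longrightarrow> j \<in> {1..n} \<Longrightarrow> c i j = c\<^sub>0"
begin

abbreviation "T \<equiv> T_alg R n c"
abbreviation "f \<equiv> T_gen R n c"

sublocale T: ring T
  unfolding T_alg_def by (rule ring_presented_algebra) (rule R.cring_axioms)

sublocale M: module R T
  unfolding T_alg_def by (rule module_presented_algebra) (rule R.cring_axioms)

lemma T_smult_l: "a \<in> carrier R \<Longrightarrow> x \<in> carrier T \<Longrightarrow> y \<in> carrier T
    \<Longrightarrow> (a \<odot>\<^bsub>T\<^esub> x) \<otimes>\<^bsub>T\<^esub> y = a \<odot>\<^bsub>T\<^esub> (x \<otimes>\<^bsub>T\<^esub> y)"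
  and T_smult_r: "a \<in> carrier R \<Longrightarrow> x \<in> carrier T \<Longrightarrow> y \<in> carrier T
    \<Longrightarrow> x \<otimes>\<^bsub>T\<^esub> (a \<odot>\<^bsub>T\<^esub> y) = a \<odot>\<^bsub>T\<^esub> (x \<otimes>\<^bsub>T\<^esub> y)"
  unfolding T_alg_def
  using presented_algebra_smult_assoc[OF R.cring_axioms, where X = "{1..n} \<times> {1..n}"
      and Rel = "T_relations n c"] by blast+

lemma c\<^sub>0_closed [simp]: "c\<^sub>0 \<in> carrier R" "inv c\<^sub>0 \<in> carrier R"
  and c\<^sub>0_inv [simp]: "inv c\<^sub>0 \<otimes> c\<^sub>0 = \<one>" "c\<^sub>0 \<otimes> inv c\<^sub>0 = \<one>"
  using c\<^sub>0_unit by (simp_all add: R.Units_closed)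

lemma f_closed [simp]: "i \<in> {1..n} \<Longrightarrow> j \<in> {1..n} \<Longrightarrow> f i j \<in> carrier T"
  by (rule T_gen_mult(1)[OF R.cring_axioms, of n c i j i i]) (simp_all add: c_const)

lemma f_mult:
  "i \<in> {1..n} \<Longrightarrow> j \<in> {1..n} \<Longrightarrow> k \<in> {1..n} \<Longrightarrow> l \<in> {1..n}
    \<Longrightarrow> f i j \<otimes>\<^bsub>T\<^esub> f k l = c\<^sub>0 \<odot>\<^bsub>T\<^esub> f i l"
  using T_gen_mult(2)[OF R.cring_axioms, of n c i j k l] by (simp add: c_const)

section \<open>A spanning set of T_n and equality of operators\<close>

text \<open>Products and negatives are deliberately not among the rules: once the span is known to
  be everything, its induction rule checks linear statements only on 1 and the f_{i,j}.\<close>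

inductive_set T_span :: "('a, nat \<times> nat) alg_term set set" where
  one: "\<one>\<^bsub>T\<^esub> \<in> T_span"
| gen: "i \<in> {1..n} \<Longrightarrow> j \<in> {1..n} \<Longrightarrow> f i j \<in> T_span"
| add: "x \<in> T_span \<Longrightarrow> y \<in> T_span \<Longrightarrow> x \<oplus>\<^bsub>T\<^esub> y \<in> T_span"
| smult: "a \<in> carrier R \<Longrightarrow> x \<in> T_span \<Longrightarrow> a \<odot>\<^bsub>T\<^esub> x \<in> T_span"

lemma T_span_closed: "x \<in> T_span \<Longrightarrow> x \<in> carrier T"
  by (induction rule: T_span.induct) simp_all

lemma T_span_mult: "x \<in> T_span \<Longrightarrow> y \<in> T_span \<Longrightarrow> x \<otimes>\<^bsub>T\<^esub> y \<in> T_span"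
proof (induction rule: T_span.induct)
  \<comment> \<open>Only this case needs a second induction, on the right factor; two generators
    multiply to a scalar multiple of a generator.\<close>
  case (gen i j)
  from gen(3) show ?case
    by (induction rule: T_span.induct)
      (use gen(1,2) in \<open>simp_all add: T_span_closed T_span.intros f_mult T.r_distr T_smult_r\<close>)
qed (simp_all add: T_span_closed T_span.intros T.l_distr T_smult_l)

text \<open>By structural induction on terms: a scalar is a multiple of 1, negation is
  multiplication by -1, and products are absorbed by \<open>T_span_mult\<close>.\<close>

lemma carrier_T_eq_span: "carrier T = T_span"
proof
  define X where "X = {1..n} \<times> {1..n}"
  let ?Rel = "T_relations n c"
  let ?cl = "\<lambda>t. alg_cong R X ?Rel `` {t}"
  have T: "T = presented_algebra R X ?Rel" by (simp add: T_alg_def X_def)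
  note ops = presented_algebra_simps[OF R.ring_axioms, of _ X _ _ ?Rel, folded T]
  have cl: "t \<in> alg_terms R X \<Longrightarrow> ?cl t \<in> carrier T" for t
    by (simp add: T presented_algebra_def quotientI)
  have one: "?cl (Scal \<one>) = \<one>\<^bsub>T\<^esub>" and zero: "?cl (Scal \<zero>) = \<zero>\<^bsub>T\<^esub>"
    by (simp_all add: T presented_algebra_def)
  note eq = equiv_class_eq[OF equiv_alg_cong[OF R.ring_axioms]]
  have "?cl t \<in> T_span" if "t \<in> alg_terms R X" for t
    using that
  proof (induction t)
    case (Scal a)
    then have "(Mul (Scal a) (Scal \<one>), Scal (a \<otimes> \<one>)) \<in> alg_cong R X ?Rel"
      by (intro alg_cong.sym[OF alg_cong.scal_mul]) simp
    from eq[OF this] have "?cl (Scal a) = a \<odot>\<^bsub>T\<^esub> \<one>\<^bsub>T\<^esub>"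
      using Scal by (simp add: ops(3)[where s = "Scal \<one>"] flip: one)
    with Scal show ?case by (simp add: T_span.intros)
  next
    case (Gen x)
    then obtain i j where x: "x = (i, j)" and "i \<in> {1..n}" "j \<in> {1..n}" by (auto simp: X_def)
    then show ?case unfolding x X_def T_gen_def[symmetric] by (intro T_span.gen)
  next
    case (Neg t)
    then have t: "t \<in> alg_terms R X" by simp
    have "?cl (Neg t) \<oplus>\<^bsub>T\<^esub> ?cl t = \<zero>\<^bsub>T\<^esub>"
      using eq[OF alg_cong.add_neg[OF t]] t by (simp add: ops(2)[OF _ _ R.zero_closed] zero)
    then have "?cl (Neg t) = \<ominus>\<^bsub>T\<^esub> ?cl t"
      using t by (simp add: T.minus_equality cl)
    also have "\<dots> = (\<ominus> \<one>) \<odot>\<^bsub>T\<^esub> ?cl t"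
      using t by (simp add: M.smult_l_minus cl)
    finally show ?case using Neg by (simp add: T_span.smult)
  next
    case (Add s t)
    then show ?case
      using T_span.add[of "?cl s" "?cl t"] by (simp add: ops(2)[OF _ _ R.zero_closed])
  next
    case (Mul s t)
    then show ?case
      using T_span_mult[of "?cl s" "?cl t"] by (simp add: ops(1)[OF _ _ R.zero_closed])
  qed
  then show "carrier T \<subseteq> T_span"
    by (auto simp: T presented_algebra_def elim!: quotientE)
  show "T_span \<subseteq> carrier T" by (auto simp: T_span_closed)
qed

lemma T_induct [consumes 1, case_names one gen add smult]:
  assumes "x \<in> carrier T"
    and "P \<one>\<^bsub>T\<^esub>"
    and "\<And>i j. i \<in> {1..n} \<Longrightarrow> j \<in> {1..n} \<Longrightarrow> P (f i j)"
    and "\<And>x y. x \<in> carrier T \<Longrightarrow> y \<in> carrier T \<Longrightarrow> P x \<Longrightarrow> P y \<Longrightarrow> P (x \<oplus>\<^bsub>T\<^esub> y)"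
    and "\<And>a x. a \<in> carrier R \<Longrightarrow> x \<in> carrier T \<Longrightarrow> P x \<Longrightarrow> P (a \<odot>\<^bsub>T\<^esub> x)"
  shows "P x"
  using assms(1) unfolding carrier_T_eq_span
  by (induction rule: T_span.induct) (auto intro: assms(2-) simp: T_span_closed)

text \<open>This supplies the uniqueness behind the definite description in
  \<open>phi\<close>.\<close>

lemma linear_ops_eqI:
  assumes g: "g \<in> linear_ops R T" and h: "h \<in> linear_ops R T"
    and "g \<one>\<^bsub>T\<^esub> = h \<one>\<^bsub>T\<^esub>"
    and "\<And>i j. i \<in> {1..n} \<Longrightarrow> j \<in> {1..n} \<Longrightarrow> g (f i j) = h (f i j)"
  shows "g = h"
proof (rule extensionalityI[of _ "carrier T"])
  show "g \<in> extensional (carrier T)" "h \<in> extensional (carrier T)"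
    using g h by (auto simp: linear_ops_def PiE_def)
  show "g x = h x" if "x \<in> carrier T" for x
    using that by (induction rule: T_induct) (use g h assms(3,4) in \<open>simp_all add: linear_ops_def\<close>)
qed

text \<open>Hence the diagonal elements generate the algebra. The formula is also the one that
  prescribes \<phi>(X_i) on f_{k,l}, so every algebra endomorphism satisfies that clause.\<close>

lemma f_factor:
  assumes "k \<in> {1..n}" "l \<in> {1..n}"
  shows "f k l = inv c\<^sub>0 \<odot>\<^bsub>T\<^esub> (f k k \<otimes>\<^bsub>T\<^esub> f l l)"
  using assms by (simp add: f_mult flip: M.smult_assoc1)

lemma alg_endos_eqI:
  assumes g: "g \<in> alg_endos R T" and h: "h \<in> alg_endos R T"
    and eq: "\<And>k. k \<in> {1..n} \<Longrightarrow> g (f k k) = h (f k k)"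
  shows "g = h"
proof (rule linear_ops_eqI)
  note [simp] = alg_endos_simps[OF g] alg_endos_simps[OF h]
  show "g \<in> linear_ops R T" "h \<in> linear_ops R T" using g h by (auto simp: alg_endos_def)
  show "g \<one>\<^bsub>T\<^esub> = h \<one>\<^bsub>T\<^esub>" by simp
  show "g (f k l) = h (f k l)" if "k \<in> {1..n}" "l \<in> {1..n}" for k l
    using that by (simp add: f_factor[OF that] eq)
qed

section \<open>Homomorphisms out of T_n\<close>

lemma T_hom:
  assumes "ring S" and \<iota>: "\<iota> \<in> ring_hom R S"
    and "\<And>a x. a \<in> carrier R \<Longrightarrow> x \<in> carrier S \<Longrightarrow> \<iota> a \<otimes>\<^bsub>S\<^esub> x = x \<otimes>\<^bsub>S\<^esub> \<iota> a"
    and "\<And>i j. i \<in> {1..n} \<Longrightarrow> j \<in> {1..n} \<Longrightarrow> F i j \<in> carrier S"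
    and rel: "\<And>i j k l. i \<in> {1..n} \<Longrightarrow> j \<in> {1..n} \<Longrightarrow> k \<in> {1..n} \<Longrightarrow> l \<in> {1..n}
      \<Longrightarrow> F i j \<otimes>\<^bsub>S\<^esub> F k l = \<iota> c\<^sub>0 \<otimes>\<^bsub>S\<^esub> F i l"
  obtains h where "h \<in> ring_hom T S"
    and "\<And>a x. a \<in> carrier R \<Longrightarrow> x \<in> carrier T \<Longrightarrow> h (a \<odot>\<^bsub>T\<^esub> x) = \<iota> a \<otimes>\<^bsub>S\<^esub> h x"
    and "\<And>i j. i \<in> {1..n} \<Longrightarrow> j \<in> {1..n} \<Longrightarrow> h (f i j) = F i j"
proof (rule presented_algebra_hom[OF R.cring_axioms assms(1-3), of "{1..n} \<times> {1..n}"
      "\<lambda>(i, j). F i j" "T_relations n c"])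
  fix h
  assume h: "h \<in> ring_hom (presented_algebra R ({1..n} \<times> {1..n}) (T_relations n c)) S"
    "\<And>a x. a \<in> carrier R
      \<Longrightarrow> x \<in> carrier (presented_algebra R ({1..n} \<times> {1..n}) (T_relations n c))
      \<Longrightarrow> h (a \<odot>\<^bsub>presented_algebra R ({1..n} \<times> {1..n}) (T_relations n c)\<^esub> x) = \<iota> a \<otimes>\<^bsub>S\<^esub> h x"
    "\<And>x. x \<in> {1..n} \<times> {1..n}
      \<Longrightarrow> h (alg_cong R ({1..n} \<times> {1..n}) (T_relations n c) `` {Gen x}) = (case x of (i, j) \<Rightarrow> F i j)"
  show thesis
    by (rule that[of h]) (use h in \<open>simp_all add: T_alg_def T_gen_def\<close>)
qed (use assms(4) rel in \<open>auto simp: T_relations_def c_const\<close>)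

text \<open>The constant family \<open>c\<^sub>0\<close> satisfies the relations in
  \<open>R\<close>, since both sides become the square of \<open>c\<^sub>0\<close>.\<close>

lemma augmentation:
  obtains \<epsilon> where "\<epsilon> \<in> ring_hom T R"
    and "\<And>a x. a \<in> carrier R \<Longrightarrow> x \<in> carrier T \<Longrightarrow> \<epsilon> (a \<odot>\<^bsub>T\<^esub> x) = a \<otimes> \<epsilon> x"
    and "\<And>i j. i \<in> {1..n} \<Longrightarrow> j \<in> {1..n} \<Longrightarrow> \<epsilon> (f i j) = c\<^sub>0"
proof (rule T_hom[of R "\<lambda>a. a" "\<lambda>i j. c\<^sub>0"])
  fix \<epsilon> assume "\<epsilon> \<in> ring_hom T R"
    "\<And>a x. a \<in> carrier R \<Longrightarrow> x \<in> carrier T \<Longrightarrow> \<epsilon> (a \<odot>\<^bsub>T\<^esub> x) = a \<otimes> \<epsilon> x"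
    "\<And>i j. i \<in> {1..n} \<Longrightarrow> j \<in> {1..n} \<Longrightarrow> \<epsilon> (f i j) = c\<^sub>0"
  then show thesis by (rule that)
qed (auto simp: R.ring_axioms R.m_comm intro: ring_hom_memI)

text \<open>Both sides are linear in \<open>x\<close>, so the spanning set suffices; for a generator
  both equal the square of \<open>c\<^sub>0\<close> times f_{k,l}.\<close>

lemma sandwich:
  assumes \<epsilon>: "\<epsilon> \<in> ring_hom T R"
    and \<epsilon>_smult: "\<And>a x. a \<in> carrier R \<Longrightarrow> x \<in> carrier T \<Longrightarrow> \<epsilon> (a \<odot>\<^bsub>T\<^esub> x) = a \<otimes> \<epsilon> x"
    and \<epsilon>_f: "\<And>i j. i \<in> {1..n} \<Longrightarrow> j \<in> {1..n} \<Longrightarrow> \<epsilon> (f i j) = c\<^sub>0"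
    and "x \<in> carrier T" and k: "k \<in> {1..n}" and l: "l \<in> {1..n}"
  shows "f k k \<otimes>\<^bsub>T\<^esub> x \<otimes>\<^bsub>T\<^esub> f l l = \<epsilon> x \<odot>\<^bsub>T\<^esub> (f k k \<otimes>\<^bsub>T\<^esub> f l l)"
  using assms(4)
proof (induction rule: T_induct)
  case one
  then show ?case using k l by (simp add: ring_hom_one[OF \<epsilon>])
next
  case (gen i j)
  then show ?case using k l by (simp add: f_mult T_smult_l \<epsilon>_f)
next
  case (add x y)
  then show ?case
    using k l ring_hom_closed[OF \<epsilon>]
    by (simp add: ring_hom_add[OF \<epsilon>] T.l_distr T.r_distr M.smult_l_distr)
next
  case (smult a x)
  then show ?case
    using k l ring_hom_closed[OF \<epsilon>]
    by (simp add: \<epsilon>_smult T_smult_l T_smult_r M.smult_assoc1)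
qed

text \<open>The conjugates F_k inherit from the f_{k,k} the rule F_k F_k = c F_k and the sandwich
  property, and these two imply all relations for the products F_i F_j / c. The map
  \<open>\<pi>\<close> need not be injective: \<open>Y_unit\<close> uses a constant one.\<close>

lemma conj_endo:
  assumes P: "\<And>k. k \<in> {1..n} \<Longrightarrow> P k \<in> Units T"
    and \<pi>: "\<And>k. k \<in> {1..n} \<Longrightarrow> \<pi> k \<in> {1..n}"
  obtains g where "g \<in> alg_endos R T"
    and "\<And>k. k \<in> {1..n} \<Longrightarrow> g (f k k) = P k \<otimes>\<^bsub>T\<^esub> f (\<pi> k) (\<pi> k) \<otimes>\<^bsub>T\<^esub> inv\<^bsub>T\<^esub> P k"
proof -
  obtain \<epsilon> where \<epsilon>: "\<epsilon> \<in> ring_hom T R"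
    and \<epsilon>_smult: "\<And>a x. a \<in> carrier R \<Longrightarrow> x \<in> carrier T \<Longrightarrow> \<epsilon> (a \<odot>\<^bsub>T\<^esub> x) = a \<otimes> \<epsilon> x"
    and \<epsilon>_f: "\<And>i j. i \<in> {1..n} \<Longrightarrow> j \<in> {1..n} \<Longrightarrow> \<epsilon> (f i j) = c\<^sub>0"
    by (rule augmentation) blast
  have sandwich: "f k k \<otimes>\<^bsub>T\<^esub> x \<otimes>\<^bsub>T\<^esub> f l l = \<epsilon> x \<odot>\<^bsub>T\<^esub> (f k k \<otimes>\<^bsub>T\<^esub> f l l)"
    if "x \<in> carrier T" "k \<in> {1..n}" "l \<in> {1..n}" for x k l
    by (rule sandwich) (use \<epsilon> \<epsilon>_smult \<epsilon>_f that in blast)+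
  note \<epsilon>_mult = ring_hom_mult[OF \<epsilon>]
  have \<epsilon>_closed [simp]: "x \<in> carrier T \<Longrightarrow> \<epsilon> x \<in> carrier R" for x
    by (rule ring_hom_closed[OF \<epsilon>])
  have P_closed [simp]: "P k \<in> carrier T" "inv\<^bsub>T\<^esub> P k \<in> carrier T"
    and P_inv [simp]: "P k \<otimes>\<^bsub>T\<^esub> inv\<^bsub>T\<^esub> P k = \<one>\<^bsub>T\<^esub>" "inv\<^bsub>T\<^esub> P k \<otimes>\<^bsub>T\<^esub> P k = \<one>\<^bsub>T\<^esub>"
    if "k \<in> {1..n}" for k
    using P[OF that] by (simp_all add: T.Units_closed)
  define F where "F k = P k \<otimes>\<^bsub>T\<^esub> f (\<pi> k) (\<pi> k) \<otimes>\<^bsub>T\<^esub> inv\<^bsub>T\<^esub> P k" for k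
  have F_closed [simp]: "F k \<in> carrier T" if "k \<in> {1..n}" for k
    using that \<pi> by (simp add: F_def)
  \<comment> \<open>Conjugation is invisible to \<open>\<epsilon>\<close>, whose values
    commute.\<close>
  have \<epsilon>_F: "\<epsilon> (F k) = c\<^sub>0" if k: "k \<in> {1..n}" for k
  proof -
    have "\<epsilon> (F k) = c\<^sub>0 \<otimes> (\<epsilon> (P k) \<otimes> \<epsilon> (inv\<^bsub>T\<^esub> P k))"
      using k \<pi> by (simp add: F_def \<epsilon>_mult \<epsilon>_f R.m_ac)
    also have "\<epsilon> (P k) \<otimes> \<epsilon> (inv\<^bsub>T\<^esub> P k) = \<one>"
      using k by (simp add: ring_hom_one[OF \<epsilon>] flip: \<epsilon>_mult)
    finally show ?thesis by simp
  qed
  have F_sandwich: "F k \<otimes>\<^bsub>T\<^esub> x \<otimes>\<^bsub>T\<^esub> F l = \<epsilon> x \<odot>\<^bsub>T\<^esub> (F k \<otimes>\<^bsub>T\<^esub> F l)"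
    if k: "k \<in> {1..n}" and l: "l \<in> {1..n}" and x: "x \<in> carrier T" for k l x
  proof -
    note cl = \<pi>[OF k] \<pi>[OF l] k l x
    \<comment> \<open>The element that the scalar multiplies does not depend on \<open>y\<close>, so
      comparing y = x with y = 1 extracts the factor \<open>\<epsilon> x\<close>.\<close>
    have F': "F k \<otimes>\<^bsub>T\<^esub> y \<otimes>\<^bsub>T\<^esub> F l = (\<epsilon> (inv\<^bsub>T\<^esub> P k) \<otimes> \<epsilon> y \<otimes> \<epsilon> (P l)) \<odot>\<^bsub>T\<^esub>
      (P k \<otimes>\<^bsub>T\<^esub> (f (\<pi> k) (\<pi> k) \<otimes>\<^bsub>T\<^esub> f (\<pi> l) (\<pi> l)) \<otimes>\<^bsub>T\<^esub> inv\<^bsub>T\<^esub> P l)"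
      if y: "y \<in> carrier T" for y
    proof -
      have "F k \<otimes>\<^bsub>T\<^esub> y \<otimes>\<^bsub>T\<^esub> F l = P k \<otimes>\<^bsub>T\<^esub>
        (f (\<pi> k) (\<pi> k) \<otimes>\<^bsub>T\<^esub> (inv\<^bsub>T\<^esub> P k \<otimes>\<^bsub>T\<^esub> y \<otimes>\<^bsub>T\<^esub> P l) \<otimes>\<^bsub>T\<^esub> f (\<pi> l) (\<pi> l)) \<otimes>\<^bsub>T\<^esub> inv\<^bsub>T\<^esub> P l"
        using cl y by (simp add: F_def T.m_assoc)
      then show ?thesis
        using cl y by (simp add: sandwich \<epsilon>_mult T_smult_l T_smult_r)
    qed
    show ?thesis
      using F'[OF x] F'[OF T.one_closed] cl
      by (simp add: ring_hom_one[OF \<epsilon>] R.m_ac flip: M.smult_assoc1)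
  qed
  have F_idem: "F k \<otimes>\<^bsub>T\<^esub> F k = c\<^sub>0 \<odot>\<^bsub>T\<^esub> F k" if k: "k \<in> {1..n}" for k
  proof -
    note cl = \<pi>[OF k] k
    have "F k \<otimes>\<^bsub>T\<^esub> F k = P k \<otimes>\<^bsub>T\<^esub> (f (\<pi> k) (\<pi> k) \<otimes>\<^bsub>T\<^esub> (inv\<^bsub>T\<^esub> P k \<otimes>\<^bsub>T\<^esub> P k)
        \<otimes>\<^bsub>T\<^esub> f (\<pi> k) (\<pi> k)) \<otimes>\<^bsub>T\<^esub> inv\<^bsub>T\<^esub> P k"
      using cl by (simp add: F_def T.m_assoc del: P_inv)
    then show ?thesis using cl by (simp add: f_mult F_def T_smult_l T_smult_r)
  qed
  define \<iota> where "\<iota> a = a \<odot>\<^bsub>T\<^esub> \<one>\<^bsub>T\<^esub>" for a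
  have \<iota>_mult: "\<iota> a \<otimes>\<^bsub>T\<^esub> x = a \<odot>\<^bsub>T\<^esub> x" "x \<otimes>\<^bsub>T\<^esub> \<iota> a = a \<odot>\<^bsub>T\<^esub> x"
    if "a \<in> carrier R" "x \<in> carrier T" for a x
    using that by (simp_all add: \<iota>_def T_smult_l T_smult_r)
  have \<iota>: "\<iota> \<in> ring_hom R T"
    by (rule ring_hom_memI)
      (simp_all add: \<iota>_def T_smult_l M.smult_assoc1 M.smult_l_distr)
  \<comment> \<open>By \<open>f_factor\<close> these values on f_{i,j} are forced by f_{k,k} being
    sent to F_k; for i = j, \<open>F_idem\<close> turns them back into F_i.\<close>
  obtain h where h: "h \<in> ring_hom T T"
    "\<And>a x. a \<in> carrier R \<Longrightarrow> x \<in> carrier T \<Longrightarrow> h (a \<odot>\<^bsub>T\<^esub> x) = \<iota> a \<otimes>\<^bsub>T\<^esub> h x"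
    "\<And>i j. i \<in> {1..n} \<Longrightarrow> j \<in> {1..n} \<Longrightarrow> h (f i j) = inv c\<^sub>0 \<odot>\<^bsub>T\<^esub> (F i \<otimes>\<^bsub>T\<^esub> F j)"
  proof (rule T_hom[OF T.ring_axioms \<iota>, of "\<lambda>i j. inv c\<^sub>0 \<odot>\<^bsub>T\<^esub> (F i \<otimes>\<^bsub>T\<^esub> F j)"])
    fix i j k l assume ijkl: "i \<in> {1..n}" "j \<in> {1..n}" "k \<in> {1..n}" "l \<in> {1..n}"
    have "F i \<otimes>\<^bsub>T\<^esub> F j \<otimes>\<^bsub>T\<^esub> (F k \<otimes>\<^bsub>T\<^esub> F l) = F i \<otimes>\<^bsub>T\<^esub> (F j \<otimes>\<^bsub>T\<^esub> F k) \<otimes>\<^bsub>T\<^esub> F l"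
      using ijkl by (simp add: T.m_assoc)
    \<comment> \<open>The sandwiched element is F_j F_k, with augmentation the square of
      \<open>c\<^sub>0\<close>.\<close>
    also have "\<dots> = (c\<^sub>0 \<otimes> c\<^sub>0) \<odot>\<^bsub>T\<^esub> (F i \<otimes>\<^bsub>T\<^esub> F l)"
      using ijkl by (simp add: F_sandwich \<epsilon>_mult \<epsilon>_F)
    finally have FF: "F i \<otimes>\<^bsub>T\<^esub> F j \<otimes>\<^bsub>T\<^esub> (F k \<otimes>\<^bsub>T\<^esub> F l) = (c\<^sub>0 \<otimes> c\<^sub>0) \<odot>\<^bsub>T\<^esub> (F i \<otimes>\<^bsub>T\<^esub> F l)" .
    have "inv c\<^sub>0 \<otimes> (inv c\<^sub>0 \<otimes> (c\<^sub>0 \<otimes> c\<^sub>0)) = \<one>"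
      by (simp flip: R.m_assoc)
    with ijkl FF show "(inv c\<^sub>0 \<odot>\<^bsub>T\<^esub> (F i \<otimes>\<^bsub>T\<^esub> F j)) \<otimes>\<^bsub>T\<^esub> (inv c\<^sub>0 \<odot>\<^bsub>T\<^esub> (F k \<otimes>\<^bsub>T\<^esub> F l))
      = \<iota> c\<^sub>0 \<otimes>\<^bsub>T\<^esub> (inv c\<^sub>0 \<odot>\<^bsub>T\<^esub> (F i \<otimes>\<^bsub>T\<^esub> F l))"
      by (simp add: \<iota>_mult T_smult_l T_smult_r flip: M.smult_assoc1)
  qed (simp_all add: \<iota>_mult)
  let ?g = "restrict h (carrier T)"
  have h_closed [simp]: "x \<in> carrier T \<Longrightarrow> h x \<in> carrier T" for x
    by (rule ring_hom_closed[OF h(1)])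
  show ?thesis
  proof
    show "?g \<in> alg_endos R T"
      unfolding alg_endos_def linear_ops_def
      by (auto simp: h(2) \<iota>_mult ring_hom_one[OF h(1)] ring_hom_mult[OF h(1)]
          ring_hom_add[OF h(1)] intro!: ring_hom_memI)
    show "?g (f k k) = P k \<otimes>\<^bsub>T\<^esub> f (\<pi> k) (\<pi> k) \<otimes>\<^bsub>T\<^esub> inv\<^bsub>T\<^esub> P k" if "k \<in> {1..n}" for k
      using that by (simp add: h(3) F_idem flip: M.smult_assoc1 F_def)
  qed
qed

end

section \<open>The action on the units \<open>Y\<^sub>k\<close>\<close>

text \<open>Units are assumed only for i < n, the indices whose inverses enter the formulas for
  \<phi>(X_i); \<open>Y_unit\<close> adds the index n when n is at least 2.\<close>

locale T_units = T_algebra +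
  fixes \<alpha> \<beta> :: "nat \<Rightarrow> 'a" and \<alpha>\<^sub>0 \<beta>\<^sub>0 :: 'a
  assumes \<alpha>\<^sub>0_unit: "\<alpha>\<^sub>0 \<in> Units R" and \<beta>\<^sub>0_closed [simp]: "\<beta>\<^sub>0 \<in> carrier R"
    and \<alpha>_const: "\<And>k. k \<in> {1..n} \<Longrightarrow> \<alpha> k = \<alpha>\<^sub>0"
    and \<beta>_const: "\<And>k. k \<in> {1..n} \<Longrightarrow> \<beta> k = \<beta>\<^sub>0"
    and Y_unit_lt: "\<And>i. i \<in> {1..<n} \<Longrightarrow> Y_elem R n c \<alpha> \<beta> i \<in> Units (T_alg R n c)"
begin

abbreviation "Y \<equiv> Y_elem R n c \<alpha> \<beta>"
abbreviation "\<phi> \<equiv> phi R n c \<alpha> \<beta>"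

lemma \<alpha>\<^sub>0_closed [simp]: "\<alpha>\<^sub>0 \<in> carrier R" "inv \<alpha>\<^sub>0 \<in> carrier R"
  and \<alpha>\<^sub>0_inv [simp]: "inv \<alpha>\<^sub>0 \<otimes> \<alpha>\<^sub>0 = \<one>"
  using \<alpha>\<^sub>0_unit by (simp_all add: R.Units_closed)

lemma Y_eq: "k \<in> {1..n} \<Longrightarrow> Y k = \<alpha>\<^sub>0 \<odot>\<^bsub>T\<^esub> f k k \<oplus>\<^bsub>T\<^esub> \<beta>\<^sub>0 \<odot>\<^bsub>T\<^esub> \<one>\<^bsub>T\<^esub>"
  by (simp add: Y_elem_def \<alpha>_const \<beta>_const)

lemma Y_closed [simp]: "k \<in> {1..n} \<Longrightarrow> Y k \<in> carrier T"
  by (simp add: Y_eq)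

text \<open>Solving for f_{k,k} is possible because \<open>\<alpha>\<^sub>0\<close> is a unit; this
  makes the Y_k algebra generators.\<close>

lemma f_eq_Y: "f k k = inv \<alpha>\<^sub>0 \<odot>\<^bsub>T\<^esub> (Y k \<oplus>\<^bsub>T\<^esub> (\<ominus> \<beta>\<^sub>0) \<odot>\<^bsub>T\<^esub> \<one>\<^bsub>T\<^esub>)" if "k \<in> {1..n}"
proof -
  have "\<beta>\<^sub>0 \<odot>\<^bsub>T\<^esub> \<one>\<^bsub>T\<^esub> \<oplus>\<^bsub>T\<^esub> (\<ominus> \<beta>\<^sub>0) \<odot>\<^bsub>T\<^esub> \<one>\<^bsub>T\<^esub> = \<zero>\<^bsub>T\<^esub>"
    by (simp add: R.r_neg flip: M.smult_l_distr)
  then have "Y k \<oplus>\<^bsub>T\<^esub> (\<ominus> \<beta>\<^sub>0) \<odot>\<^bsub>T\<^esub> \<one>\<^bsub>T\<^esub> = \<alpha>\<^sub>0 \<odot>\<^bsub>T\<^esub> f k k"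
    using that by (simp add: Y_eq T.a_assoc)
  then show ?thesis
    using that by (simp flip: M.smult_assoc1)
qed

lemma alg_endos_eqI_Y:
  assumes g: "g \<in> alg_endos R T" and h: "h \<in> alg_endos R T"
    and eq: "\<And>k. k \<in> {1..n} \<Longrightarrow> g (Y k) = h (Y k)"
  shows "g = h"
proof (rule alg_endos_eqI[OF g h])
  show "g (f k k) = h (f k k)" if "k \<in> {1..n}" for k
    using that by (simp add: f_eq_Y alg_endos_simps[OF g] alg_endos_simps[OF h] eq)
qed

text \<open>Conjugation fixes the scalar \<open>\<beta>\<^sub>0\<close>, and constancy of the
  parameters makes the conjugated element Y_{\<pi> k} again.\<close>

lemma conj_endo_Y:
  assumes P: "\<And>k. k \<in> {1..n} \<Longrightarrow> P k \<in> Units T"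
    and \<pi>: "\<And>k. k \<in> {1..n} \<Longrightarrow> \<pi> k \<in> {1..n}"
  obtains g where "g \<in> alg_endos R T"
    and "\<And>k. k \<in> {1..n} \<Longrightarrow> g (f k k) = P k \<otimes>\<^bsub>T\<^esub> f (\<pi> k) (\<pi> k) \<otimes>\<^bsub>T\<^esub> inv\<^bsub>T\<^esub> P k"
    and "\<And>k. k \<in> {1..n} \<Longrightarrow> g (Y k) = P k \<otimes>\<^bsub>T\<^esub> Y (\<pi> k) \<otimes>\<^bsub>T\<^esub> inv\<^bsub>T\<^esub> P k"
proof -
  obtain g where g: "g \<in> alg_endos R T"
    and gf: "\<And>k. k \<in> {1..n} \<Longrightarrow> g (f k k) = P k \<otimes>\<^bsub>T\<^esub> f (\<pi> k) (\<pi> k) \<otimes>\<^bsub>T\<^esub> inv\<^bsub>T\<^esub> P k"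
    using conj_endo[of P \<pi>] P \<pi> by blast
  have "g (Y k) = P k \<otimes>\<^bsub>T\<^esub> Y (\<pi> k) \<otimes>\<^bsub>T\<^esub> inv\<^bsub>T\<^esub> P k" if k: "k \<in> {1..n}" for k
    using k P[OF k] \<pi>[OF k] T.Units_closed[OF P[OF k]]
    by (simp add: Y_eq alg_endos_simps[OF g] gf T.l_distr T.r_distr T_smult_l T_smult_r)
  with g gf show ?thesis by (rule that)
qed

text \<open>The endomorphism with trivial conjugators and constant index map k sends Y_1 to Y_k, and
  ring homomorphisms preserve units. For n = 1 the hypothesis on units is vacuous, whence the bound
  on n.\<close>

lemma Y_unit:
  assumes "2 \<le> n" and k: "k \<in> {1..n}"
  shows "Y k \<in> Units T"
proof -
  define P where "P j = \<one>\<^bsub>T\<^esub>" for j :: nat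
  define \<pi> where "\<pi> j = k" for j :: nat
  have P: "P j \<in> Units T" "\<pi> j \<in> {1..n}" for j
    using k by (auto simp: P_def \<pi>_def)
  obtain g where g: "g \<in> alg_endos R T"
    and "\<And>j. j \<in> {1..n} \<Longrightarrow> g (f j j) = P j \<otimes>\<^bsub>T\<^esub> f (\<pi> j) (\<pi> j) \<otimes>\<^bsub>T\<^esub> inv\<^bsub>T\<^esub> P j"
    and gY: "\<And>j. j \<in> {1..n} \<Longrightarrow> g (Y j) = P j \<otimes>\<^bsub>T\<^esub> Y (\<pi> j) \<otimes>\<^bsub>T\<^esub> inv\<^bsub>T\<^esub> P j"
    using conj_endo_Y[of P \<pi>] P by blast
  have "g (Y 1) \<in> Units T"
    by (rule ring_hom_inv(1)[OF T.monoid_axioms T.monoid_axioms])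
      (use g Y_unit_lt[of 1] \<open>2 \<le> n\<close> in \<open>simp_all add: alg_endos_def\<close>)
  then show ?thesis using gY[of 1] k \<open>2 \<le> n\<close> by (simp add: P_def \<pi>_def)
qed

lemma Y_inv_closed [simp]: "2 \<le> n \<Longrightarrow> k \<in> {1..n} \<Longrightarrow> inv\<^bsub>T\<^esub> Y k \<in> carrier T"
  by (simp add: Y_unit)

text \<open>With products bracketed to the right, these rules carry out free reduction of words in
  the Y_k and their inverses; the versions with a tail \<open>x\<close> cancel inside a
  word.\<close>

lemma Y_cancel [simp]:
  assumes "2 \<le> n" "k \<in> {1..n}"
  shows "Y k \<otimes>\<^bsub>T\<^esub> inv\<^bsub>T\<^esub> Y k = \<one>\<^bsub>T\<^esub>" "inv\<^bsub>T\<^esub> Y k \<otimes>\<^bsub>T\<^esub> Y k = \<one>\<^bsub>T\<^esub>"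
    and "x \<in> carrier T \<Longrightarrow> Y k \<otimes>\<^bsub>T\<^esub> (inv\<^bsub>T\<^esub> Y k \<otimes>\<^bsub>T\<^esub> x) = x"
    and "x \<in> carrier T \<Longrightarrow> inv\<^bsub>T\<^esub> Y k \<otimes>\<^bsub>T\<^esub> (Y k \<otimes>\<^bsub>T\<^esub> x) = x"
  using Y_unit[OF assms] T.Units_closed[OF Y_unit[OF assms]]
  by (simp_all flip: T.m_assoc)

lemma alg_endos_inv_Y:
  assumes "g \<in> alg_endos R T" "2 \<le> n" "k \<in> {1..n}"
  shows "g (inv\<^bsub>T\<^esub> Y k) = inv\<^bsub>T\<^esub> g (Y k)"
  by (rule ring_hom_inv(2)[OF T.monoid_axioms T.monoid_axioms])
    (use assms Y_unit in \<open>simp_all add: alg_endos_def\<close>)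

section \<open>The operators \<phi>(X_i) as Artin automorphisms\<close>

text \<open>Conjugating by Y_i at index i only, with the transposition of i and i+1 as index map,
  gives an endomorphism meeting the specification \<open>is_phi\<close>. As only one operator meets
  it, this endomorphism is \<open>\<phi> i\<close>.\<close>

lemma phi_endo:
  assumes i: "i \<in> {1..<n}"
  shows "\<phi> i \<in> alg_endos R T"
    and "\<phi> i (Y i) = Y i \<otimes>\<^bsub>T\<^esub> Y (Suc i) \<otimes>\<^bsub>T\<^esub> inv\<^bsub>T\<^esub> Y i"
    and "\<phi> i (Y (Suc i)) = Y i"
    and "\<And>k. k \<in> {1..n} \<Longrightarrow> k \<noteq> i \<Longrightarrow> k \<noteq> Suc i \<Longrightarrow> \<phi> i (Y k) = Y k"
proof -
  have n: "2 \<le> n" and ii: "i \<in> {1..n}" "Suc i \<in> {1..n}" using i by auto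
  note units = Y_unit[OF n ii(1)] T.Units_closed[OF Y_unit[OF n ii(1)]]
  define P where "P k = (if k = i then Y i else \<one>\<^bsub>T\<^esub>)" for k
  define \<pi> where "\<pi> = id(i := Suc i, Suc i := i)"
  have P: "P k \<in> Units T" "\<pi> k \<in> {1..n}" if "k \<in> {1..n}" for k
    using that units ii by (auto simp: P_def \<pi>_def)
  obtain g where g: "g \<in> alg_endos R T"
    and gf: "\<And>k. k \<in> {1..n} \<Longrightarrow> g (f k k) = P k \<otimes>\<^bsub>T\<^esub> f (\<pi> k) (\<pi> k) \<otimes>\<^bsub>T\<^esub> inv\<^bsub>T\<^esub> P k"
    and gY: "\<And>k. k \<in> {1..n} \<Longrightarrow> g (Y k) = P k \<otimes>\<^bsub>T\<^esub> Y (\<pi> k) \<otimes>\<^bsub>T\<^esub> inv\<^bsub>T\<^esub> P k"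
    using conj_endo_Y[of P \<pi>] P by blast
  note gs = alg_endos_simps[OF g]
  have \<alpha>i: "\<alpha> i = \<alpha>\<^sub>0" "\<beta> i = \<beta>\<^sub>0" using ii by (simp_all add: \<alpha>_const \<beta>_const)
  have gfi: "g (f i i) = Y i \<otimes>\<^bsub>T\<^esub> f (Suc i) (Suc i) \<otimes>\<^bsub>T\<^esub> inv\<^bsub>T\<^esub> Y i"
    using gf[OF ii(1)] by (simp add: P_def \<pi>_def)
  \<comment> \<open>Write f_{i+1,i+1} through Y_{i+1}; the conjugation by Y_i leaves the scalar part
    alone.\<close>
  also have "\<dots> = inv \<alpha>\<^sub>0 \<odot>\<^bsub>T\<^esub> (Y i \<otimes>\<^bsub>T\<^esub> Y (Suc i) \<otimes>\<^bsub>T\<^esub> inv\<^bsub>T\<^esub> Y i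
      \<ominus>\<^bsub>T\<^esub> \<beta>\<^sub>0 \<odot>\<^bsub>T\<^esub> \<one>\<^bsub>T\<^esub>)"
    using ii n units by (simp add: f_eq_Y T.l_distr T.r_distr T_smult_l T_smult_r 
        T.minus_eq M.smult_l_minus T.l_minus T.r_minus)
  finally have gfi: "g (f i i) = \<dots>" .
  have gfj: "g (f (Suc i) (Suc i)) = f i i" using gf[OF ii(2)] ii by (simp add: P_def \<pi>_def)
  have gfk: "g (f k k) = f k k" if "k \<in> {1..n}" "k \<noteq> i" "k \<noteq> Suc i" for k
    using gf[OF that(1)] that by (simp add: P_def \<pi>_def)
  have gkl: "g (f k l) = inv (c k l) \<odot>\<^bsub>T\<^esub> (g (f k k) \<otimes>\<^bsub>T\<^esub> g (f l l))"
    if "k \<in> {1..n}" "l \<in> {1..n}" for k l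
    using that by (simp add: f_factor[OF that] gs c_const)
  have is_phi: "is_phi R n c \<alpha> \<beta> i g"
    unfolding is_phi_def Let_def
  proof (intro conjI ballI impI)
    show "g \<in> linear_ops R T" using g by (simp add: alg_endos_def)
    show "g (f i i) = inv (\<alpha> i) \<odot>\<^bsub>T\<^esub>
        (Y i \<otimes>\<^bsub>T\<^esub> Y (i + 1) \<otimes>\<^bsub>T\<^esub> inv\<^bsub>T\<^esub> Y i \<ominus>\<^bsub>T\<^esub> \<beta> i \<odot>\<^bsub>T\<^esub> \<one>\<^bsub>T\<^esub>)"
      using gfi by (simp add: \<alpha>i)
    show "g (f (i + 1) (i + 1)) = f i i" using gfj by simp
    show "g (f k k) = f k k" if "k \<in> {1..n} - {i, i + 1}" for k
      using gfk[of k] that by auto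
    show "g \<one>\<^bsub>T\<^esub> = \<one>\<^bsub>T\<^esub>" by (rule gs(2))
    show "g (f k l) = inv (c k l) \<odot>\<^bsub>T\<^esub> (g (f k k) \<otimes>\<^bsub>T\<^esub> g (f l l))"
      if "k \<in> {1..n}" "l \<in> {1..n}" for k l
      using that by (rule gkl)
  qed
  \<comment> \<open>A competitor \<open>h\<close> is only known to be linear, so all f_{k,l} are
    compared; off the diagonal both maps obey the same product formula.\<close>
  have "h = g" if h: "is_phi R n c \<alpha> \<beta> i h" for h
  proof (rule linear_ops_eqI)
    show "h \<in> linear_ops R T" "g \<in> linear_ops R T" "h \<one>\<^bsub>T\<^esub> = g \<one>\<^bsub>T\<^esub>"
      using h is_phi by (simp_all add: is_phi_def Let_def)
    have hi: "h (f i i) = inv (\<alpha> i) \<odot>\<^bsub>T\<^esub>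
        (Y i \<otimes>\<^bsub>T\<^esub> Y (i + 1) \<otimes>\<^bsub>T\<^esub> inv\<^bsub>T\<^esub> Y i \<ominus>\<^bsub>T\<^esub> \<beta> i \<odot>\<^bsub>T\<^esub> \<one>\<^bsub>T\<^esub>)"
      and hj: "h (f (i + 1) (i + 1)) = f i i"
      and hk: "\<forall>k\<in>{1..n} - {i, i + 1}. h (f k k) = f k k"
      and hkl: "\<forall>k\<in>{1..n}. \<forall>l\<in>{1..n}. k \<noteq> l \<longrightarrow>
        h (f k l) = inv (c k l) \<odot>\<^bsub>T\<^esub> (h (f k k) \<otimes>\<^bsub>T\<^esub> h (f l l))"
      using h unfolding is_phi_def Let_def by blast+
    have diag: "h (f k k) = g (f k k)" if k: "k \<in> {1..n}" for k
    proof -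
      consider "k = i" | "k = Suc i" | "k \<noteq> i" "k \<noteq> Suc i" by blast
      then show ?thesis
      proof cases
        case 1 then show ?thesis using hi gfi \<alpha>i by simp
      next
        case 2 then show ?thesis using hj gfj by simp
      next
        case 3 then show ?thesis using hk gfk k by simp
      qed
    qed
    show "h (f k l) = g (f k l)" if "k \<in> {1..n}" "l \<in> {1..n}" for k l
    proof (cases "k = l")
      case False
      with that hkl have "h (f k l) = inv (c k l) \<odot>\<^bsub>T\<^esub> (h (f k k) \<otimes>\<^bsub>T\<^esub> h (f l l))" by blast
      then show ?thesis by (simp only: diag[OF that(1)] diag[OF that(2)] gkl[OF that])
    qed (use that diag in simp)
  qed
  then have "\<phi> i = g"
    unfolding phi_def using is_phi by (intro the_equality)
  with g show "\<phi> i \<in> alg_endos R T" by simp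
  show "\<phi> i (Y i) = Y i \<otimes>\<^bsub>T\<^esub> Y (Suc i) \<otimes>\<^bsub>T\<^esub> inv\<^bsub>T\<^esub> Y i"
    using gY[OF ii(1)] by (simp add: \<open>\<phi> i = g\<close> P_def \<pi>_def)
  show "\<phi> i (Y (Suc i)) = Y i"
    using gY[OF ii(2)] ii by (simp add: \<open>\<phi> i = g\<close> P_def \<pi>_def)
  show "\<phi> i (Y k) = Y k" if "k \<in> {1..n}" "k \<noteq> i" "k \<noteq> Suc i" for k
    using gY[OF that(1)] that by (simp add: \<open>\<phi> i = g\<close> P_def \<pi>_def)
qed

text \<open>Writing the images of inverses as words in the Y_k and their inverses allows composites
  of the operators to be computed by rewriting.\<close>

lemma phi_inv:
  assumes i: "i \<in> {1..<n}"
  shows "\<phi> i (inv\<^bsub>T\<^esub> Y i) = Y i \<otimes>\<^bsub>T\<^esub> inv\<^bsub>T\<^esub> Y (Suc i) \<otimes>\<^bsub>T\<^esub> inv\<^bsub>T\<^esub> Y i"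
    and "\<phi> i (inv\<^bsub>T\<^esub> Y (Suc i)) = inv\<^bsub>T\<^esub> Y i"
    and "\<And>k. k \<in> {1..n} \<Longrightarrow> k \<noteq> i \<Longrightarrow> k \<noteq> Suc i \<Longrightarrow> \<phi> i (inv\<^bsub>T\<^esub> Y k) = inv\<^bsub>T\<^esub> Y k"
proof -
  have n: "2 \<le> n" and ii: "i \<in> {1..n}" "Suc i \<in> {1..n}" using i by auto
  note inv_Y = alg_endos_inv_Y[OF phi_endo(1)[OF i] n]
  have "inv\<^bsub>T\<^esub> (Y i \<otimes>\<^bsub>T\<^esub> Y (Suc i) \<otimes>\<^bsub>T\<^esub> inv\<^bsub>T\<^esub> Y i)
    = Y i \<otimes>\<^bsub>T\<^esub> inv\<^bsub>T\<^esub> Y (Suc i) \<otimes>\<^bsub>T\<^esub> inv\<^bsub>T\<^esub> Y i"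
    by (rule T.inv_char) (use n ii in \<open>simp_all add: T.m_assoc del: atLeastAtMost_iff\<close>)
  then show "\<phi> i (inv\<^bsub>T\<^esub> Y i) = Y i \<otimes>\<^bsub>T\<^esub> inv\<^bsub>T\<^esub> Y (Suc i) \<otimes>\<^bsub>T\<^esub> inv\<^bsub>T\<^esub> Y i"
    using ii i by (simp add: inv_Y phi_endo)
  show "\<phi> i (inv\<^bsub>T\<^esub> Y (Suc i)) = inv\<^bsub>T\<^esub> Y i"
    using ii i by (simp add: inv_Y phi_endo)
  show "\<And>k. k \<in> {1..n} \<Longrightarrow> k \<noteq> i \<Longrightarrow> k \<noteq> Suc i \<Longrightarrow> \<phi> i (inv\<^bsub>T\<^esub> Y k) = inv\<^bsub>T\<^esub> Y k"
    using i by (simp add: inv_Y phi_endo)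
qed

lemmas compose_endos = compose_alg_endos[OF _ _ M.module_axioms T.ring_axioms]

text \<open>The inverse is Artin's inverse automorphism, sending Y_i to Y_{i+1} and Y_{i+1} to
  Y_{i+1}^-1 Y_i Y_{i+1}. It again has the form of \<open>conj_endo_Y\<close>, now with the
  conjugator Y_{i+1}^-1 at index i+1.\<close>

lemma phi_in_linear_group:
  assumes i: "i \<in> {1..<n}"
  shows "\<phi> i \<in> carrier (linear_group R T)"
proof -
  have n: "2 \<le> n" and ii: "i \<in> {1..n}" "Suc i \<in> {1..n}" using i by auto
  define P where "P k = (if k = Suc i then inv\<^bsub>T\<^esub> Y (Suc i) else \<one>\<^bsub>T\<^esub>)" for k
  define \<pi> where "\<pi> = id(i := Suc i, Suc i := i)"
  have P: "P k \<in> Units T" "\<pi> k \<in> {1..n}" if "k \<in> {1..n}" for k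
    using that Y_unit[OF n ii(2)] ii by (auto simp: P_def \<pi>_def)
  obtain h where h: "h \<in> alg_endos R T"
    and "\<And>k. k \<in> {1..n} \<Longrightarrow> h (f k k) = P k \<otimes>\<^bsub>T\<^esub> f (\<pi> k) (\<pi> k) \<otimes>\<^bsub>T\<^esub> inv\<^bsub>T\<^esub> P k"
    and hY: "\<And>k. k \<in> {1..n} \<Longrightarrow> h (Y k) = P k \<otimes>\<^bsub>T\<^esub> Y (\<pi> k) \<otimes>\<^bsub>T\<^esub> inv\<^bsub>T\<^esub> P k"
    using conj_endo_Y[of P \<pi>] P by blast
  have hi: "h (Y i) = Y (Suc i)"
    and hj: "h (Y (Suc i)) = inv\<^bsub>T\<^esub> Y (Suc i) \<otimes>\<^bsub>T\<^esub> Y i \<otimes>\<^bsub>T\<^esub> Y (Suc i)"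
    using hY[OF ii(1)] hY[OF ii(2)] ii Y_unit[OF n ii(2)] by (simp_all add: P_def \<pi>_def)
  have hk: "k \<in> {1..n} \<Longrightarrow> k \<noteq> i \<Longrightarrow> k \<noteq> Suc i \<Longrightarrow> h (Y k) = Y k" for k
    using hY[of k] by (simp add: P_def \<pi>_def)
  note p = phi_endo[OF i] phi_inv[OF i]
  note simps = compose_eq alg_endos_simps[OF h] alg_endos_simps[OF p(1)] p(2-) hi hj hk
    alg_endos_inv_Y[OF h n] T.m_assoc
  note endos = compose_endos id_alg_endos[OF M.module_axioms T.ring_axioms] h p(1)
  have "compose (carrier T) (\<phi> i) h = (\<lambda>x\<in>carrier T. x)"
  proof (rule alg_endos_eqI_Y)
    show "compose (carrier T) (\<phi> i) h (Y k) = (\<lambda>x\<in>carrier T. x) (Y k)" if "k \<in> {1..n}" for k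
      using that n ii by (cases "k = i"; cases "k = Suc i") (simp_all add: simps)
  qed (rule endos)+
  moreover have "compose (carrier T) h (\<phi> i) = (\<lambda>x\<in>carrier T. x)"
  proof (rule alg_endos_eqI_Y)
    show "compose (carrier T) h (\<phi> i) (Y k) = (\<lambda>x\<in>carrier T. x) (Y k)" if "k \<in> {1..n}" for k
      using that n ii by (cases "k = i"; cases "k = Suc i") (simp_all add: simps)
  qed (rule endos)+
  ultimately show ?thesis by (rule Bij_alg_endos[OF p(1) h])
qed

lemma linear_group_mult:
  assumes "g \<in> carrier (linear_group R T)" "h \<in> carrier (linear_group R T)"
  shows "g \<otimes>\<^bsub>linear_group R T\<^esub> h = compose (carrier T) g h"
  using assms by (simp add: linear_group_def BijGroup_def)

section \<open>The braid relations and the representation\<close>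

text \<open>With a, b, d for Y_i, Y_{i+1}, Y_{i+2}, both composites send a to a b d b^-1 a^-1, b to
  a b a^-1 and d to a, and fix the other Y_k.\<close>

lemma phi_braid:
  assumes i: "i \<in> {1..<n}" and j: "Suc i \<in> {1..<n}"
  shows "compose (carrier T) (\<phi> i) (compose (carrier T) (\<phi> (Suc i)) (\<phi> i))
    = compose (carrier T) (\<phi> (Suc i)) (compose (carrier T) (\<phi> i) (\<phi> (Suc i)))"
proof (rule alg_endos_eqI_Y)
  note E = phi_endo(1)[OF i] phi_endo(1)[OF j]
  show "compose (carrier T) (\<phi> i) (compose (carrier T) (\<phi> (Suc i)) (\<phi> i)) \<in> alg_endos R T"
    by (rule compose_endos[OF E(1) compose_endos[OF E(2) E(1)]])
  show "compose (carrier T) (\<phi> (Suc i)) (compose (carrier T) (\<phi> i) (\<phi> (Suc i))) \<in> alg_endos R T"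
    by (rule compose_endos[OF E(2) compose_endos[OF E(1) E(2)]])
  have n: "2 \<le> n" and ijk: "i \<in> {1..n}" "Suc i \<in> {1..n}" "Suc (Suc i) \<in> {1..n}" using i j by auto
  note p = phi_endo[OF i] phi_inv[OF i] and q = phi_endo[OF j] phi_inv[OF j]
  note simps = compose_eq alg_endos_simps[OF p(1)] alg_endos_simps[OF q(1)] p(2-) q(2-) T.m_assoc
  show "compose (carrier T) (\<phi> i) (compose (carrier T) (\<phi> (Suc i)) (\<phi> i)) (Y k)
    = compose (carrier T) (\<phi> (Suc i)) (compose (carrier T) (\<phi> i) (\<phi> (Suc i))) (Y k)"
    if "k \<in> {1..n}" for k
  proof -
    consider "k = i" | "k = Suc i" | "k = Suc (Suc i)" | "k \<noteq> i" "k \<noteq> Suc i" "k \<noteq> Suc (Suc i)"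
      by blast
    then show ?thesis by cases (use that n ijk in \<open>simp_all add: simps\<close>)
  qed
qed

text \<open>The index pairs {i, i+1} and {j, j+1} are disjoint, so each operator fixes the units
  that the other one moves.\<close>

lemma phi_commute:
  assumes i: "i \<in> {1..<n}" and j: "j \<in> {1..<n}" and ij: "\<bar>int i - int j\<bar> > 1"
  shows "compose (carrier T) (\<phi> i) (\<phi> j) = compose (carrier T) (\<phi> j) (\<phi> i)"
proof (rule alg_endos_eqI_Y)
  note E = phi_endo(1)[OF i] phi_endo(1)[OF j]
  show "compose (carrier T) (\<phi> i) (\<phi> j) \<in> alg_endos R T"
    by (rule compose_endos[OF E])
  show "compose (carrier T) (\<phi> j) (\<phi> i) \<in> alg_endos R T"
    by (rule compose_endos[OF E(2,1)])
  have n: "2 \<le> n" and ii: "i \<in> {1..n}" "Suc i \<in> {1..n}" "j \<in> {1..n}" "Suc j \<in> {1..n}"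
    using i j by auto
  have ne: "i \<noteq> j" "Suc i \<noteq> j" "i \<noteq> Suc j" "j \<noteq> i" "j \<noteq> Suc i" "Suc j \<noteq> i" using ij by auto
  note p = phi_endo[OF i] phi_inv[OF i] and q = phi_endo[OF j] phi_inv[OF j]
  note simps = compose_eq alg_endos_simps[OF p(1)] alg_endos_simps[OF q(1)] p(2-) q(2-) T.m_assoc
  show "compose (carrier T) (\<phi> i) (\<phi> j) (Y k) = compose (carrier T) (\<phi> j) (\<phi> i) (Y k)"
    if "k \<in> {1..n}" for k
  proof -
    consider "k = i" | "k = Suc i" | "k = j" | "k = Suc j"
      | "k \<noteq> i" "k \<noteq> Suc i" "k \<noteq> j" "k \<noteq> Suc j"
      by blast
    then show ?thesis by cases (use that n ii ne in \<open>simp_all add: simps\<close>)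
  qed
qed

lemma braid_representation:
  "\<exists>\<Phi> \<in> hom (braid_group n) (linear_group R T). \<forall>i\<in>{1..<n}. \<Phi> (braid_gen n i) = \<phi> i"
proof -
  let ?G = "linear_group R T"
  interpret G: group ?G by (rule group_linear_group) (rule M.module_axioms)
  have braid: "\<phi> i \<otimes>\<^bsub>?G\<^esub> (\<phi> (Suc i) \<otimes>\<^bsub>?G\<^esub> \<phi> i) = \<phi> (Suc i) \<otimes>\<^bsub>?G\<^esub> (\<phi> i \<otimes>\<^bsub>?G\<^esub> \<phi> (Suc i))"
    if "i \<in> {1..<n}" "Suc i \<in> {1..<n}" for i
    using phi_in_linear_group[OF that(1)] phi_in_linear_group[OF that(2)] phi_braid[OF that]
      G.m_closed[of "\<phi> i" "\<phi> (Suc i)"] G.m_closed[of "\<phi> (Suc i)" "\<phi> i"]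
    by (simp add: linear_group_mult)
  have commute: "\<phi> i \<otimes>\<^bsub>?G\<^esub> \<phi> j = \<phi> j \<otimes>\<^bsub>?G\<^esub> \<phi> i"
    if "i \<in> {1..<n}" "j \<in> {1..<n}" "\<bar>int i - int j\<bar> > 1" for i j
    using that phi_in_linear_group phi_commute[OF that] by (simp add: linear_group_mult)
  have rel: "word_eval ?G \<phi> u = word_eval ?G \<phi> v" if uv: "(u, v) \<in> braid_relations n" for u v
  proof -
    from uv consider (near) i j where "u = [(i, True), (j, True), (i, True)]"
        "v = [(j, True), (i, True), (j, True)]" "i \<in> {1..<n}" "j \<in> {1..<n}" "\<bar>int i - int j\<bar> = 1"
      | (far) i j where "u = [(i, True), (j, True)]" "v = [(j, True), (i, True)]"
        "i \<in> {1..<n}" "j \<in> {1..<n}" "\<bar>int i - int j\<bar> > 1"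
      unfolding braid_relations_def by blast
    then show ?thesis
    proof cases
      case (near i j)
      \<comment> \<open>The relation set contains both orders of neighbouring indices; they give the
        same equation read in opposite directions.\<close>
      then have "j = Suc i \<or> i = Suc j" by auto
      with near(3,4) have "\<phi> i \<otimes>\<^bsub>?G\<^esub> (\<phi> j \<otimes>\<^bsub>?G\<^esub> \<phi> i) = \<phi> j \<otimes>\<^bsub>?G\<^esub> (\<phi> i \<otimes>\<^bsub>?G\<^esub> \<phi> j)"
        using braid[of i] braid[of j] by auto
      with near show ?thesis using phi_in_linear_group by simp
    next
      case (far i j)
      with commute[OF far(3-5)] show ?thesis using phi_in_linear_group by simp
    qed
  qed
  obtain \<Phi> where "\<Phi> \<in> hom (presented_group {1..<n} (braid_relations n)) ?G"
    "\<And>i. i \<in> {1..<n} \<Longrightarrow> \<Phi> (group_cong {1..<n} (braid_relations n) `` {[(i, True)]}) = \<phi> i"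
    using presented_group_hom[OF G.group_axioms, of "{1..<n}" \<phi> "braid_relations n"]
      phi_in_linear_group rel by blast
  then show ?thesis unfolding braid_group_def braid_gen_def by blast
qed

end

theorem proposition5:
  fixes R :: "('a, 'm) ring_scheme" (structure)
    and n :: nat
    and c :: "nat \<Rightarrow> nat \<Rightarrow> 'a"
    and \<alpha> \<beta> :: "nat \<Rightarrow> 'a"
    and \<beta>\<^sub>0 c\<^sub>0 :: 'a
  assumes "domain R"
    and "\<And>i j. i \<in> {1..n} \<Longrightarrow> j \<in> {1..n} \<Longrightarrow> c i j \<in> Units R"
    and "\<And>i. i \<in> {1..n} \<Longrightarrow> \<alpha> i \<in> Units R"
    and "\<And>i. i \<in> {1..n} \<Longrightarrow> \<beta> i \<in> carrier R"
    and "\<And>i. i \<in> {1..<n} \<Longrightarrow> Y_elem R n c \<alpha> \<beta> i \<in> Units (T_alg R n c)"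
    and "\<beta>\<^sub>0 \<in> carrier R" and "c\<^sub>0 \<in> carrier R"
    and "\<And>i. i \<in> {1..n} \<Longrightarrow> \<beta> i = \<beta>\<^sub>0"
    and "\<And>i. i \<in> {2..n} \<Longrightarrow> \<alpha> i = c (i - 1) (i - 1) \<otimes> \<alpha> (i - 1) \<otimes> inv (c i i)"
    and "\<And>i j. i \<in> {1..n} \<Longrightarrow> j \<in> {1..n} \<Longrightarrow> c i j = c\<^sub>0"
  shows "\<exists>\<Phi> \<in> hom (braid_group n) (linear_group R (T_alg R n c)).
    \<forall>i\<in>{1..<n}. \<Phi> (braid_gen n i) = phi R n c \<alpha> \<beta> i"
proof -
  interpret R: domain R by fact
  \<comment> \<open>For \<open>n = 0\<close> the hypotheses do not make \<open>c\<^sub>0\<close> or any \<open>\<alpha> i\<close> a unit.\<close>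
  define d where "d = (if n = 0 then \<one> else c\<^sub>0)"
  define a where "a = (if n = 0 then \<one> else \<alpha> 1)"
  have d: "d \<in> Units R" "\<And>i j. i \<in> {1..n} \<Longrightarrow> j \<in> {1..n} \<Longrightarrow> c i j = d"
    using assms(2)[of 1 1] assms(10) by (auto simp: d_def)
  have a: "a \<in> Units R" using assms(3)[of 1] by (auto simp: a_def)
  \<comment> \<open>For constant c the factors in the recursion (2) cancel, so all \<alpha>_k equal
    \<alpha>_1.\<close>
  have \<alpha>: "\<alpha> k = a" if "k \<in> {1..n}" for k
    using that
  proof (induction k)
    case (Suc k)
    show ?case
    proof (cases "k = 0")
      case False
      then have k: "k \<in> {1..n}" using Suc.prems by simp
      have "\<alpha> (Suc k) = d \<otimes> a \<otimes> inv d"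
        using assms(9)[of "Suc k"] Suc.IH[OF k] Suc.prems k False d(2)[OF k k]
          d(2)[OF Suc.prems Suc.prems] by simp
      also have "\<dots> = a \<otimes> (d \<otimes> inv d)"
        using a d(1) by (simp add: R.m_ac R.Units_closed)
      finally show ?thesis using a d(1) by (simp add: R.Units_closed)
    qed (use Suc.prems in \<open>simp add: a_def\<close>)
  qed simp
  interpret T_units R n c d \<alpha> \<beta> a \<beta>\<^sub>0
    by unfold_locales (use d a \<alpha> assms(5,6,8) in auto)
  show ?thesis by (rule braid_representation)
qed

end
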